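(* Let $D\subseteq\mathbb{R}^l$ be non-empty, $U\subseteq\mathbb{R}^m$, and let $f:D\times\mathbb{R}^n\times U\to\mathbb{R}^n$ satisfy the standing assumptions (H1) and (H2) listed in the context. Consider the control system $\dot x(t)=f(d(t),x(t),u(t))$ with $d(t)\in D$, $x(t)\in\mathbb{R}^n$, $u(t)\in U$. Suppose that the following two conditions hold. (P1) There exist a locally bounded mapping $\tilde k:\mathbb{R}^n\to U$ with $\tilde k(0)=0$, a bounded open set $\Theta\subseteq\mathbb{R}^n$ which contains a neighborhood of $0\in\mathbb{R}^n$, a function $\gamma\in K_\infty$ with $|f(d,z,\tilde k(x))|\le\gamma(|z|+|x|)$ for all $(d,z,x)\in D\times\mathbb{R}^n\times\mathbb{R}^n$, a constant $\tilde h>0$ and a function $\sigma\in KL$ such that for every $x_0\in\Theta$, every $d\in L^\infty_{loc}(\mathbb{R}^+;D)$, every measurable, locally bounded $\bar d:\mathbb{R}^+\to\mathbb{R}^+$ and every $t\ge 0$, $$|x(t)|\le\sigma(|x_0|,t),\qquad x(t)\in\Theta,$$ where $x(t)$ denotes the solution of the sampled-data system $$\dot x(t)=f(d(t),x(t),\tilde k(x(\tau_i))),\ t\in[\tau_i,\tau_{i+1}),\qquad \tau_0=0,\ \tau_{i+1}=\tau_i+\tilde h\exp(-\bar d(\tau_i)),\ i=0,1,\dots$$ with initial condition $x(0)=x_0$. (P3) There exist a constant $r>0$ and a sequence of sets $\Omega_j\subseteq\mathbb{R}^n$, $j=1,2,\dots$, with $\Omega_1=\Theta$ and $\bigcup_{j=1}^\infty\Omega_j=\mathbb{R}^n$,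 such that for each $j\in\{2,3,\dots\}$ the set $\bigcup_{i=1}^{j-1}\Omega_i$ is $r$-robustly reachable from $\Omega_j$ for the system $\dot x=f(d,x,u)$ with constant control. Moreover, for each compact $K\subseteq\mathbb{R}^n$ there exists $N\in\{2,3,\dots\}$ such that $K\subseteq\bigcup_{j=1}^N\Omega_j$. Then the equilibrium point $0\in\mathbb{R}^n$ of $\dot x=f(d,x,u)$ is robustly globally stabilizable by means of sampled-data control with positive sampling rate.
   Context: Notation. $\mathbb{R}^+=[0,+\infty)$; $|\cdot|$ is the Euclidean norm; $x'$ is the transpose of $x$. $L^\infty_{loc}(\mathbb{R}^+;D)$ is the class of Lebesgue measurable, locally essentially bounded maps $d:\mathbb{R}^+\to D$. Class $N$: non-decreasing continuous $\gamma:\mathbb{R}^+\to\mathbb{R}^+$ with $\gamma(0)=0$. Class $K$: continuous strictly increasing $\gamma:\mathbb{R}^+\to\mathbb{R}^+$ with $\gamma(0)=0$; $K_\infty$: unbounded functions of class $K$. Class $KL$: continuous $\sigma:\mathbb{R}^+\times\mathbb{R}^+\to\mathbb{R}^+$ such that $\sigma(\cdot,t)$ is of class $K$ for each $t\ge0$, and for each $s\ge0$ the map $\sigma(s,\cdot)$ is non-increasing with $\lim_{t\to+\infty}\sigma(s,t)=0$. Standing assumptions. (H1) $f$ is continuous on $D\times\mathbb{R}^n\times U$ and for every bounded $S\subset\mathbb{R}^n\times U$ there exists $L\ge0$ such that $(x-y)'(f(d,x,u)-f(d,y,u))\le L|x-y|^2$ for all $d\in D$ and all $(x,u)\in S$,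 $(y,u)\in S$. (H2) There exists $a\in K_\infty$ such that $|f(d,x,u)|\le a(|x|+|u|)$ for all $(u,d,x)\in U\times D\times\mathbb{R}^n$. Solutions are absolutely continuous functions satisfying the differential equation almost everywhere. A solution of a sampled-data system $\dot x(t)=f(d(t),x(t),k(x(\tau_i)))$, $t\in[\tau_i,\tau_{i+1})$, $\tau_0=0$, $\tau_{i+1}=\tau_i+h\exp(-\tilde d(\tau_i))$, is built step by step: given $\tau_i$ and $x(\tau_i)$, compute $\tau_{i+1}$, solve the differential equation on $[\tau_i,\tau_{i+1})$ with the control held constant at $k(x(\tau_i))$, and set $x(\tau_{i+1})=\lim_{t\to\tau_{i+1}^-}x(t)$. Robust reachability. Let $r>0$. A set $A\subseteq\mathbb{R}^n$ is $r$-robustly reachable from a set $\Omega\subseteq\mathbb{R}^n$ for $\dot x=f(d,x,u)$ with constant control if there exist $v\in U$, $c\ge0$ and functions $a,b\in N$ such that: for every $x_0\in\Omega$ and $d\in L^\infty_{loc}(\mathbb{R}^+;D)$ there exists $T(d,x_0)\in[0,c+b(|x_0|)]$ such that the solution $x(t)$ of $\dot x=f(d,x,u)$ with $u(t)\equiv v$ and $x(0)=x_0$ exists for all $t\in[0,T(d,x_0)+r]$ and satisfies: (i) $|x(t)|\le a(|x_0|)$ for all $t\in[0,T(d,x_0)+r]$; (ii) $x(t)\in A$ for all $t\in[T(d,x_0),T(d,x_0)+r]$; (iii) $x(t)\in\Omega$ for all $t\in[0,T(d,x_0)]$. Robust global stabilizability. The equilibrium point $0$ of $\dot x=f(d,x,u)$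 is robustly globally stabilizable by means of sampled-data control with positive sampling rate if there exist a locally bounded mapping $k:\mathbb{R}^n\to U$ with $k(0)=0$, a function $\kappa\in K_\infty$ with $|f(d,z,k(x))|\le\kappa(|z|+|x|)$ for all $(d,z,x)\in D\times\mathbb{R}^n\times\mathbb{R}^n$, a constant $h>0$ and a function $\sigma\in KL$ such that for all $x_0\in\mathbb{R}^n$, all $d\in L^\infty_{loc}(\mathbb{R}^+;D)$, all measurable, locally bounded $\tilde d:\mathbb{R}^+\to\mathbb{R}^+$ and all $t\ge0$ one has $|x(t)|\le\sigma(|x_0|,t)$, where $x(t)$ is the solution of $\dot x(t)=f(d(t),x(t),k(x(\tau_i)))$, $t\in[\tau_i,\tau_{i+1})$, $\tau_0=0$, $\tau_{i+1}=\tau_i+h\exp(-\tilde d(\tau_i))$, $i=0,1,\dots$, with $x(0)=x_0$. *)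

theory Defs
  imports "HOL-Analysis.Analysis"
begin

text \<open>Functions on \<open>[0, \<infinity>)\<close> are functions on \<open>real\<close>; only their values on \<open>{0..}\<close> matter.\<close>

definition class_N :: "(real \<Rightarrow> real) \<Rightarrow> bool" where
  "class_N \<gamma> \<longleftrightarrow> \<gamma> ` {0..} \<subseteq> {0..} \<and> continuous_on {0..} \<gamma> \<and> mono_on {0..} \<gamma> \<and> \<gamma> 0 = 0"

definition class_K :: "(real \<Rightarrow> real) \<Rightarrow> bool" where
  "class_K \<gamma> \<longleftrightarrow>
     \<gamma> ` {0..} \<subseteq> {0..} \<and> continuous_on {0..} \<gamma> \<and> strict_mono_on {0..} \<gamma> \<and> \<gamma> 0 = 0"

definition class_K_infinity :: "(real \<Rightarrow> real) \<Rightarrow> bool" where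
  "class_K_infinity \<gamma> \<longleftrightarrow> class_K \<gamma> \<and> \<not> bounded (\<gamma> ` {0..})"

definition class_KL :: "(real \<Rightarrow> real \<Rightarrow> real) \<Rightarrow> bool" where
  "class_KL \<sigma> \<longleftrightarrow>
     continuous_on ({0..} \<times> {0..}) (\<lambda>(s, t). \<sigma> s t) \<and>
     (\<forall>t\<ge>0. class_K (\<lambda>s. \<sigma> s t)) \<and>
     (\<forall>s\<ge>0. antimono_on {0..} (\<sigma> s) \<and> (\<sigma> s \<longlongrightarrow> 0) at_top)"

definition locally_bounded_on ::
    "'a::topological_space set \<Rightarrow> ('a \<Rightarrow> 'b::metric_space) \<Rightarrow> bool" where
  "locally_bounded_on S g \<longleftrightarrow> (\<forall>K. compact K \<and> K \<subseteq> S \<longrightarrow> bounded (g ` K))"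

definition L_infinity_loc :: "'a::euclidean_space set \<Rightarrow> (real \<Rightarrow> 'a) set" where
  "L_infinity_loc D = {d. d ` {0..} \<subseteq> D \<and> d \<in> borel_measurable (lebesgue_on {0..}) \<and>
     (\<forall>K. compact K \<and> K \<subseteq> {0..} \<longrightarrow> (\<exists>M. AE t in lebesgue_on K. norm (d t) \<le> M))}"

definition sampling_perturbations :: "(real \<Rightarrow> real) set" where
  "sampling_perturbations = {e. e ` {0..} \<subseteq> {0..} \<and>
     e \<in> borel_measurable (lebesgue_on {0..}) \<and> locally_bounded_on {0..} e}"

text \<open>The usual \<open>\<epsilon>\<close>-\<open>\<delta>\<close> notion of absolute continuity of a function on a compact interval: a
  division consists of finitely many non-overlapping compact intervals \<open>K = [Inf K, Sup K]\<close>. It is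
  unrelated to the library constant \<^const>\<open>absolutely_continuous\<close>, which concerns measures.\<close>

definition abs_continuous_on :: "real set \<Rightarrow> (real \<Rightarrow> 'a::real_normed_vector) \<Rightarrow> bool" where
  "abs_continuous_on S x \<longleftrightarrow>
     (\<forall>\<epsilon>>0. \<exists>\<delta>>0. \<forall>\<D> T. \<D> division_of T \<and> T \<subseteq> S \<and> (\<Sum>K\<in>\<D>. Sup K - Inf K) < \<delta> \<longrightarrow>
        (\<Sum>K\<in>\<D>. norm (x (Sup K) - x (Inf K))) < \<epsilon>)"

definition solves_ode_ae ::
    "(real \<Rightarrow> 'a \<Rightarrow> 'a) \<Rightarrow> real set \<Rightarrow> (real \<Rightarrow> 'a::real_normed_vector) \<Rightarrow> bool" where
  "solves_ode_ae g I x \<longleftrightarrow>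
     (\<forall>a b. {a..b} \<subseteq> I \<longrightarrow> abs_continuous_on {a..b} x) \<and>
     (AE t in lebesgue_on I. (x has_vector_derivative g t (x t)) (at t))"

text \<open>An assertion about ``the solution'': a solution exists, and the assertion holds for it. Since
  functions are total, a solution is unique only up to its values outside the time interval on which
  it is considered, hence no unique existence quantifier.\<close>

definition solution_exists_and_satisfies ::
    "((real \<Rightarrow> 'a) \<Rightarrow> bool) \<Rightarrow> ((real \<Rightarrow> 'a) \<Rightarrow> bool) \<Rightarrow> bool" where
  "solution_exists_and_satisfies sol P \<longleftrightarrow> (\<exists>x. sol x) \<and> (\<forall>x. sol x \<longrightarrow> P x)"

primrec sampling_time :: "real \<Rightarrow> (real \<Rightarrow> real) \<Rightarrow> nat \<Rightarrow> real" where
  "sampling_time h e 0 = 0"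
| "sampling_time h e (Suc i) = sampling_time h e i + h * exp (- e (sampling_time h e i))"

text \<open>If \<open>h > 0\<close> and \<open>e\<close> is locally bounded, the sampling times tend to infinity, so that the
  conditions below determine a solution on all of \<open>[0, \<infinity>)\<close>.\<close>

definition sampled_data_solution ::
    "('d \<Rightarrow> 'a \<Rightarrow> 'u \<Rightarrow> 'a) \<Rightarrow> ('a \<Rightarrow> 'u) \<Rightarrow> real \<Rightarrow> (real \<Rightarrow> 'd) \<Rightarrow> (real \<Rightarrow> real) \<Rightarrow>
      'a \<Rightarrow> (real \<Rightarrow> 'a::real_normed_vector) \<Rightarrow> bool" where
  "sampled_data_solution f k h d e x0 x \<longleftrightarrow>
     x 0 = x0 \<and>
     (\<forall>i. let s = sampling_time h e i; s' = sampling_time h e (Suc i) in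
        solves_ode_ae (\<lambda>t z. f (d t) z (k (x s))) {s..<s'} x \<and> (x \<longlongrightarrow> x s') (at_left s'))"

definition H1 ::
    "(real^'l \<Rightarrow> real^'n \<Rightarrow> real^'m \<Rightarrow> real^'n) \<Rightarrow> (real^'l) set \<Rightarrow> (real^'m) set \<Rightarrow> bool" where
  "H1 f D U \<longleftrightarrow>
     continuous_on (D \<times> UNIV \<times> U) (\<lambda>(d, x, u). f d x u) \<and>
     (\<forall>S. bounded S \<and> S \<subseteq> UNIV \<times> U \<longrightarrow>
        (\<exists>L\<ge>0. \<forall>d\<in>D. \<forall>x y u. (x, u) \<in> S \<and> (y, u) \<in> S \<longrightarrow>
           (x - y) \<bullet> (f d x u - f d y u) \<le> L * (norm (x - y))\<^sup>2))"

definition H2 ::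
    "(real^'l \<Rightarrow> real^'n \<Rightarrow> real^'m \<Rightarrow> real^'n) \<Rightarrow> (real^'l) set \<Rightarrow> (real^'m) set \<Rightarrow> bool" where
  "H2 f D U \<longleftrightarrow>
     (\<exists>a. class_K_infinity a \<and>
        (\<forall>u\<in>U. \<forall>d\<in>D. \<forall>x. norm (f d x u) \<le> a (norm x + norm u)))"

definition robustly_reachable ::
    "(real^'l \<Rightarrow> real^'n \<Rightarrow> real^'m \<Rightarrow> real^'n) \<Rightarrow> (real^'l) set \<Rightarrow> (real^'m) set \<Rightarrow>
      real \<Rightarrow> (real^'n) set \<Rightarrow> (real^'n) set \<Rightarrow> bool" where
  "robustly_reachable f D U r A \<Omega> \<longleftrightarrow>
     (\<exists>v\<in>U. \<exists>c\<ge>0. \<exists>a b. class_N a \<and> class_N b \<and>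
        (\<forall>x0\<in>\<Omega>. \<forall>d\<in>L_infinity_loc D. \<exists>T\<in>{0..c + b (norm x0)}.
           solution_exists_and_satisfies
             (\<lambda>x. x 0 = x0 \<and> solves_ode_ae (\<lambda>t z. f (d t) z v) {0..T + r} x)
             (\<lambda>x. (\<forall>t\<in>{0..T + r}. norm (x t) \<le> a (norm x0)) \<and>
                  (\<forall>t\<in>{T..T + r}. x t \<in> A) \<and>
                  (\<forall>t\<in>{0..T}. x t \<in> \<Omega>))))"

definition robustly_globally_stabilizable ::
    "(real^'l \<Rightarrow> real^'n \<Rightarrow> real^'m \<Rightarrow> real^'n) \<Rightarrow> (real^'l) set \<Rightarrow> (real^'m) set \<Rightarrow> bool" where
  "robustly_globally_stabilizable f D U \<longleftrightarrow>
     (\<exists>k \<kappa> h \<sigma>.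
        range k \<subseteq> U \<and> locally_bounded_on UNIV k \<and> k 0 = 0 \<and>
        class_K_infinity \<kappa> \<and>
        (\<forall>d\<in>D. \<forall>z x. norm (f d z (k x)) \<le> \<kappa> (norm z + norm x)) \<and>
        h > 0 \<and> class_KL \<sigma> \<and>
        (\<forall>x0. \<forall>d\<in>L_infinity_loc D. \<forall>e\<in>sampling_perturbations.
           solution_exists_and_satisfies
             (sampled_data_solution f k h d e x0)
             (\<lambda>x. \<forall>t\<ge>0. norm (x t) \<le> \<sigma> (norm x0) t)))"

end

(* The feedback is k1 on Theta and, elsewhere, the constant control reaching
   Omega_1 Un ... Un Omega_(j-1) from Omega_j, where j is the least index with x in Omega_j. With
   sampling period h = min h1 r, some sampling instant falls into the time window of length r that the
   trajectory spends in the union of the earlier sets, so that the index drops, and by induction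
   on j the state enters Theta in a time, and with a bound, depending only on |x0|. From then on (P1)
   applies: the period h is the period h1 with the perturbation increased by ln (h1 / h). These uniform
   bounds are dominated by continuous monotone functions, hence by a KL function. Since (P3) speaks
   about a control held constant beyond the sampling instants, sampled-data solutions are compared
   with concatenations of the given ones by means of uniqueness, which follows from the one-sided
   Lipschitz condition. *)

theory Submission
  imports Defs
begin

section \<open>Absolutely continuous functions\<close>

text \<open>No solution is constructed from \<open>f\<close> itself: all solutions are glued from
  those that (P1) and (P3) provide, and (H1) enters through uniqueness. Disturbances are merely
  measurable, so solutions are differentiable only almost everywhere. Uniqueness therefore rests on
  the fact that an absolutely continuous function whose derivative is nonpositive almost everywhere
  does not increase. Continuity would not suffice (Cantor function); a gauge argument works directly
  with the epsilon-delta definition.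

  The bounds found by induction come from compactness, one radius at a time, with no information as
  the radius tends to 0. States off \<Theta> have norm at least \<open>\<epsilon>\<close>, where
  \<open>ball 0 \<epsilon>\<close> lies in \<Theta>. Multiplying by \<open>s / \<epsilon>\<close>
  thus makes these bounds vanish at 0 without weakening them where they are used, while on \<Theta>
  the estimates of (P1) apply. The gain is obtained from (H2) in the same way.

  The point of entry into \<Theta> is arbitrary, so decay after entry is measured by
  \<open>\<sigma> C\<close>, with \<open>C\<close> a bound for the norm on \<Theta>.\<close>

lemma division_endpoints:
  fixes K :: "real set"
  assumes "\<D> division_of T" "T \<subseteq> S" "K \<in> \<D>"
  shows "Sup K \<in> S" "Inf K \<in> S" "Inf K \<le> Sup K" "K = {Inf K..Sup K}"
proof -
  obtain a b where K: "K = cbox a b" using division_ofD(4)[OF assms(1,3)] by auto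
  have "K \<noteq> {}" "K \<subseteq> S" using division_ofD(2,3)[OF assms(1,3)] assms(2) by auto
  with K show "Sup K \<in> S" "Inf K \<in> S" "Inf K \<le> Sup K" "K = {Inf K..Sup K}" by auto
qed

lemma abs_continuous_on_cong:
  assumes "\<And>t. t \<in> S \<Longrightarrow> x t = y t" "abs_continuous_on S x"
  shows "abs_continuous_on S y"
proof -
  have "(\<Sum>K\<in>\<D>. norm (x (Sup K) - x (Inf K))) = (\<Sum>K\<in>\<D>. norm (y (Sup K) - y (Inf K)))"
    if "\<D> division_of T" "T \<subseteq> S" for \<D> and T
    using division_endpoints(1,2)[OF that] assms(1) by (intro sum.cong) auto
  then show ?thesis
    using assms(2) unfolding abs_continuous_on_def by (metis (no_types, lifting))
qed

lemma abs_continuous_on_imp_continuous_on: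
  assumes "abs_continuous_on {a..b} x"
  shows "continuous_on {a..b} x"
  unfolding continuous_on_iff
proof (intro ballI allI impI)
  fix s and e :: real assume s: "s \<in> {a..b}" and "e > 0"
  then obtain \<delta> where "\<delta> > 0" and \<delta>: "\<And>\<D> T. \<D> division_of T \<Longrightarrow> T \<subseteq> {a..b} \<Longrightarrow>
      (\<Sum>K\<in>\<D>. Sup K - Inf K) < \<delta> \<Longrightarrow> (\<Sum>K\<in>\<D>. norm (x (Sup K) - x (Inf K))) < e"
    using assms unfolding abs_continuous_on_def by metis
  have *: "norm (x v - x u) < e" if "u \<in> {a..b}" "v \<in> {a..b}" "u \<le> v" "v - u < \<delta>" for u v
  proof -
    have "{{u..v}} division_of {u..v}"
      using that(3) division_of_self[of u v] by simp
    from \<delta>[OF this] show ?thesis using that by simp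
  qed
  show "\<exists>d>0. \<forall>t\<in>{a..b}. dist t s < d \<longrightarrow> dist (x t) (x s) < e"
  proof (intro exI[of _ \<delta>] conjI ballI impI)
    fix t assume "t \<in> {a..b}" "dist t s < \<delta>"
    then show "dist (x t) (x s) < e"
      using *[of s t] *[of t s] s by (cases "s \<le> t") (auto simp: dist_norm norm_minus_commute)
  qed fact
qed

lemma abs_continuous_on_lipschitz:
  assumes "B \<ge> 0" "\<And>u v. u \<in> S \<Longrightarrow> v \<in> S \<Longrightarrow> u \<le> v \<Longrightarrow> norm (x v - x u) \<le> B * (v - u)"
  shows "abs_continuous_on S x"
  unfolding abs_continuous_on_def
proof (intro allI impI)
  fix e :: real assume "e > 0"
  show "\<exists>\<delta>>0. \<forall>\<D> T. \<D> division_of T \<and> T \<subseteq> S \<and> (\<Sum>K\<in>\<D>. Sup K - Inf K) < \<delta> \<longrightarrow>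
      (\<Sum>K\<in>\<D>. norm (x (Sup K) - x (Inf K))) < e"
  proof (intro exI[of _ "e / (B + 1)"] conjI allI impI)
    show "e / (B + 1) > 0" using \<open>e > 0\<close> assms(1) by simp
    fix \<D> T assume A: "\<D> division_of T \<and> T \<subseteq> S \<and> (\<Sum>K\<in>\<D>. Sup K - Inf K) < e / (B + 1)"
    have nn: "(\<Sum>K\<in>\<D>. Sup K - Inf K) \<ge> 0"
      using division_endpoints(3)[of \<D> T S] A by (intro sum_nonneg) auto
    have "(\<Sum>K\<in>\<D>. norm (x (Sup K) - x (Inf K))) \<le> (\<Sum>K\<in>\<D>. B * (Sup K - Inf K))"
      using division_endpoints(1-3)[of \<D> T S] A by (intro sum_mono assms(2)) auto
    also have "\<dots> = B * (\<Sum>K\<in>\<D>. Sup K - Inf K)" by (simp add: sum_distrib_left)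
    also have "\<dots> \<le> (B + 1) * (\<Sum>K\<in>\<D>. Sup K - Inf K)" using nn by (simp add: mult_right_mono)
    also have "\<dots> < e" using A assms(1) by (simp add: pos_less_divide_eq mult.commute)
    finally show "(\<Sum>K\<in>\<D>. norm (x (Sup K) - x (Inf K))) < e" .
  qed
qed

text \<open>Common source of the closure properties: differences and bilinear products have
  increments controlled by those of both arguments. The budget \<open>e / (2 * (B + 1))\<close>
  leaves half for each of \<open>x\<close> and \<open>y\<close> and stays meaningful for
  \<open>B = 0\<close>.\<close>

lemma abs_continuous_on_dominated:
  assumes x: "abs_continuous_on S x" and y: "abs_continuous_on S y" and "B \<ge> 0"
    and z: "\<And>u v. u \<in> S \<Longrightarrow> v \<in> S \<Longrightarrow> norm (z v - z u) \<le> B * (norm (x v - x u) + norm (y v - y u))"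
  shows "abs_continuous_on S z"
  unfolding abs_continuous_on_def
proof (intro allI impI)
  fix e :: real assume "e > 0"
  define e' where "e' = e / (2 * (B + 1))"
  have "e' > 0" using \<open>e > 0\<close> \<open>B \<ge> 0\<close> by (simp add: e'_def)
  obtain \<delta>1 where "\<delta>1 > 0" and \<delta>1: "\<And>\<D> T. \<D> division_of T \<Longrightarrow> T \<subseteq> S \<Longrightarrow>
      (\<Sum>K\<in>\<D>. Sup K - Inf K) < \<delta>1 \<Longrightarrow> (\<Sum>K\<in>\<D>. norm (x (Sup K) - x (Inf K))) < e'"
    using x \<open>e' > 0\<close> unfolding abs_continuous_on_def by metis
  obtain \<delta>2 where "\<delta>2 > 0" and \<delta>2: "\<And>\<D> T. \<D> division_of T \<Longrightarrow> T \<subseteq> S \<Longrightarrow>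
      (\<Sum>K\<in>\<D>. Sup K - Inf K) < \<delta>2 \<Longrightarrow> (\<Sum>K\<in>\<D>. norm (y (Sup K) - y (Inf K))) < e'"
    using y \<open>e' > 0\<close> unfolding abs_continuous_on_def by metis
  show "\<exists>\<delta>>0. \<forall>\<D> T. \<D> division_of T \<and> T \<subseteq> S \<and> (\<Sum>K\<in>\<D>. Sup K - Inf K) < \<delta> \<longrightarrow>
      (\<Sum>K\<in>\<D>. norm (z (Sup K) - z (Inf K))) < e"
  proof (intro exI[of _ "min \<delta>1 \<delta>2"] conjI allI impI)
    show "min \<delta>1 \<delta>2 > 0" using \<open>\<delta>1 > 0\<close> \<open>\<delta>2 > 0\<close> by simp
    fix \<D> T assume A: "\<D> division_of T \<and> T \<subseteq> S \<and> (\<Sum>K\<in>\<D>. Sup K - Inf K) < min \<delta>1 \<delta>2"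
    let ?X = "\<Sum>K\<in>\<D>. norm (x (Sup K) - x (Inf K))" and ?Y = "\<Sum>K\<in>\<D>. norm (y (Sup K) - y (Inf K))"
    have XY: "?X < e'" "?Y < e'" using \<delta>1[of \<D> T] \<delta>2[of \<D> T] A by auto
    have "?X \<ge> 0" "?Y \<ge> 0" by (auto intro: sum_nonneg)
    have "(\<Sum>K\<in>\<D>. norm (z (Sup K) - z (Inf K)))
        \<le> (\<Sum>K\<in>\<D>. B * (norm (x (Sup K) - x (Inf K)) + norm (y (Sup K) - y (Inf K))))"
      using division_endpoints(1,2)[of \<D> T S] A by (intro sum_mono z) auto
    also have "\<dots> = B * (?X + ?Y)" by (simp add: sum_distrib_left sum.distrib distrib_left)
    also have "\<dots> \<le> (B + 1) * (?X + ?Y)"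
      using \<open>?X \<ge> 0\<close> \<open>?Y \<ge> 0\<close> by (intro mult_right_mono) auto
    also have "\<dots> < (B + 1) * (2 * e')" using XY \<open>B \<ge> 0\<close> by (intro mult_strict_left_mono) auto
    also have "\<dots> = e" using \<open>B \<ge> 0\<close> by (simp add: e'_def field_simps)
    finally show "(\<Sum>K\<in>\<D>. norm (z (Sup K) - z (Inf K))) < e" .
  qed
qed

lemma abs_continuous_on_diff:
  assumes "abs_continuous_on S x" "abs_continuous_on S y"
  shows "abs_continuous_on S (\<lambda>t. x t - y t)"
proof (rule abs_continuous_on_dominated[OF assms, of 1])
  show "norm (x v - y v - (x u - y u)) \<le> 1 * (norm (x v - x u) + norm (y v - y u))" for u v
    using norm_triangle_ineq4[of "x v - x u" "y v - y u"] by (simp add: algebra_simps)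
qed simp

text \<open>Continuity on a compact interval bounds the factor that is not differenced in each half
  of the split increment. The generality serves both the inner product and the multiplication by an
  exponential weight.\<close>

lemma abs_continuous_on_bilinear:
  assumes "bounded_bilinear p"
    and x: "abs_continuous_on {a..b} x" and y: "abs_continuous_on {a..b} y"
  shows "abs_continuous_on {a..b} (\<lambda>t. p (x t) (y t))"
proof -
  interpret bounded_bilinear p by fact
  obtain K where K: "K > 0" "\<And>u v. norm (p u v) \<le> norm u * norm v * K"
    using pos_bounded by blast
  have "bounded (x ` {a..b})" "bounded (y ` {a..b})"
    using x y by (auto intro!: compact_imp_bounded compact_continuous_image
        abs_continuous_on_imp_continuous_on)
  then obtain X Y where X: "X > 0" "\<And>t. t \<in> {a..b} \<Longrightarrow> norm (x t) \<le> X"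
    and Y: "Y > 0" "\<And>t. t \<in> {a..b} \<Longrightarrow> norm (y t) \<le> Y"
    unfolding bounded_pos by auto
  show ?thesis
  proof (rule abs_continuous_on_dominated[OF x y, of "K * (X + Y)"])
    show "K * (X + Y) \<ge> 0" using K X Y by simp
    fix u v assume uv: "u \<in> {a..b}" "v \<in> {a..b}"
    have "p (x v) (y v) - p (x u) (y u) = p (x v - x u) (y v) + p (x u) (y v - y u)"
      by (simp add: diff_left diff_right)
    then have "norm (p (x v) (y v) - p (x u) (y u))
        \<le> norm (p (x v - x u) (y v)) + norm (p (x u) (y v - y u))"
      by (simp add: norm_triangle_ineq)
    also have "\<dots> \<le> norm (x v - x u) * Y * K + X * norm (y v - y u) * K"
      using K(1) X Y uv
      by (intro add_mono order_trans[OF K(2)] mult_right_mono mult_left_mono) auto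
    also have "\<dots> \<le> K * (X + Y) * (norm (x v - x u) + norm (y v - y u))"
    proof -
      have "0 \<le> X * norm (x v - x u) * K" "0 \<le> Y * norm (y v - y u) * K" using K(1) X(1) Y(1) by auto
      then show ?thesis by (simp add: algebra_simps)
    qed
    finally show "norm (p (x v) (y v) - p (x u) (y u)) \<le> K * (X + Y) * (norm (x v - x u) + norm (y v - y u))" .
  qed
qed

text \<open>Outer regularity. \<open>G\<close> becomes the gauge at exceptional tags, where
  smallness of total length lets absolute continuity control the increments.\<close>

lemma null_set_subset_small_open:
  fixes N :: "real set"
  assumes "N \<in> null_sets lebesgue" "\<delta> > 0"
  obtains G where "open G" "N \<subseteq> G" "G \<in> lmeasurable" "measure lebesgue G < \<delta>"
proof -
  have N: "N \<in> lmeasurable" "measure lebesgue N = 0"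
    using assms(1) by (auto simp: fmeasurable_def null_sets_def measure_def)
  obtain G where G: "open G" "N \<subseteq> G" "G - N \<in> lmeasurable" "emeasure lebesgue (G - N) < ennreal \<delta>"
    using sets_lebesgue_outer_open[OF _ assms(2), of N] N(1) fmeasurableD by blast
  have "G = (G - N) \<union> N" using G(2) by auto
  then have lm: "G \<in> lmeasurable" using G(3) N(1) fmeasurable.Un by metis
  have "measure lebesgue (G - N) < \<delta>"
    using G(3,4) assms(2) by (simp add: emeasure_eq_measure2 ennreal_less_iff)
  moreover have "measure lebesgue (G - N) = measure lebesgue G"
    using assms(1) lm by (simp add: fmeasurableD measure_Diff_null_set)
  ultimately show thesis using that G lm by simp
qed

text \<open>Cousin's lemma: intervals tagged off the exceptional null set \<open>N\<close> contribute at most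
  \<open>\<epsilon> * (b - a)\<close>, those tagged in \<open>N\<close> lie in an open set of measure less than \<open>\<delta>\<close>.\<close>

lemma abs_continuous_AE_deriv_nonpos:
  fixes g :: "real \<Rightarrow> real"
  assumes ac: "abs_continuous_on {a..b} g" and "a \<le> b"
    and N: "N \<in> null_sets lebesgue"
    and der: "\<And>t. t \<in> {a..b} - N \<Longrightarrow> \<exists>c\<le>0. (g has_vector_derivative c) (at t)"
  shows "g b \<le> g a"
proof -
  have main: "g b - g a \<le> e * (b - a) + e" if "e > 0" for e
  proof -
    obtain \<delta> where "\<delta> > 0" and \<delta>: "\<And>\<D> T. \<D> division_of T \<Longrightarrow> T \<subseteq> {a..b} \<Longrightarrow>
        (\<Sum>K\<in>\<D>. Sup K - Inf K) < \<delta> \<Longrightarrow> (\<Sum>K\<in>\<D>. norm (g (Sup K) - g (Inf K))) < e"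
      using ac \<open>e > 0\<close> unfolding abs_continuous_on_def by metis
    obtain G where G: "open G" "N \<subseteq> G" "G \<in> lmeasurable" "measure lebesgue G < \<delta>"
      using null_set_subset_small_open[OF N \<open>\<delta> > 0\<close>] by blast
    \<comment> \<open>Straddle estimate: with the tag between the endpoints, the errors
      \<open>e * (v - t)\<close> and \<open>e * (t - u)\<close> add up to
      \<open>e * (v - u)\<close>, and the linear term has the right sign because
      \<open>c \<le> 0\<close>.\<close>
    have "\<exists>\<rho>>0. \<forall>u v. u \<in> ball t \<rho> \<and> v \<in> ball t \<rho> \<and> u \<le> t \<and> t \<le> v \<longrightarrow> g v - g u \<le> e * (v - u)"
      if t: "t \<in> {a..b} - N" for t
    proof -
      obtain c where c: "c \<le> 0" "(g has_vector_derivative c) (at t)" using der t by blast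
      obtain \<rho> where "\<rho> > 0" and \<rho>: "\<And>s. norm (s - t) < \<rho> \<Longrightarrow>
          norm (g s - g t - (s - t) *\<^sub>R c) \<le> e * norm (s - t)"
        using c(2) \<open>e > 0\<close> unfolding has_vector_derivative_def has_derivative_at_alt by blast
      have "g v - g u \<le> e * (v - u)"
        if "u \<in> ball t \<rho>" "v \<in> ball t \<rho>" "u \<le> t" "t \<le> v" for u v
      proof -
        have "\<bar>g v - g t - (v - t) * c\<bar> \<le> e * (v - t)" "\<bar>g u - g t - (u - t) * c\<bar> \<le> e * (t - u)"
          using \<rho>[of u] \<rho>[of v] that by (auto simp: dist_norm norm_minus_commute)
        moreover have "(v - t) * c \<le> 0" "(u - t) * c \<ge> 0"
          using that c(1) by (auto simp: mult_nonneg_nonpos mult_nonpos_nonpos)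
        moreover have "e * (v - u) = e * (v - t) + e * (t - u)" by (simp add: algebra_simps)
        ultimately show ?thesis by linarith
      qed
      then show ?thesis using \<open>\<rho> > 0\<close> by blast
    qed
    then obtain \<rho> where \<rho>: "\<And>t. t \<in> {a..b} - N \<Longrightarrow> \<rho> t > 0"
      "\<And>t u v. t \<in> {a..b} - N \<Longrightarrow> u \<in> ball t (\<rho> t) \<Longrightarrow> v \<in> ball t (\<rho> t) \<Longrightarrow> u \<le> t \<Longrightarrow> t \<le> v
        \<Longrightarrow> g v - g u \<le> e * (v - u)" by metis
    \<comment> \<open>A gauge lives on the whole line; the unit balls outside \<open>{a..b}\<close>
      are a filler, as all tags lie in \<open>{a..b}\<close>.\<close>
    define R where "R t = (if t \<in> N then G else if t \<in> {a..b} then ball t (\<rho> t) else ball t 1)" for t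
    have "gauge R" unfolding gauge_def R_def using G \<rho>(1) by auto
    then obtain p where p: "p tagged_division_of {a..b}" "R fine p"
      by (rule fine_division_exists_real)
    define p1 where "p1 = {tk\<in>p. fst tk \<in> N}"
    have "finite p" using p(1) by blast
    have fin: "finite p1" "finite (p - p1)" and "p1 \<subseteq> p" using \<open>finite p\<close> by (auto simp: p1_def)
    have el: "K = {Inf K..Sup K}" "Inf K \<le> t" "t \<le> Sup K" "K \<subseteq> R t" "t \<in> {a..b}" "K \<subseteq> {a..b}"
      if tK: "(t, K) \<in> p" for t K
    proof -
      obtain u v where K: "K = {u..v}" using tagged_division_ofD(4)[OF p(1) tK] by auto
      have "t \<in> K" "K \<subseteq> {a..b}" using tagged_division_ofD(2,3)[OF p(1) that] by auto
      then show "K = {Inf K..Sup K}" "Inf K \<le> t" "t \<le> Sup K" "t \<in> {a..b}" "K \<subseteq> {a..b}"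
        using K by auto
      show "K \<subseteq> R t" using p(2) that by (auto simp: fine_def)
    qed
    have "g b - g a = (\<Sum>(t, K)\<in>p. g (Sup K) - g (Inf K))"
      using additive_tagged_division_1[OF \<open>a \<le> b\<close> p(1), of g] by simp
    also have "\<dots> = (\<Sum>(t, K)\<in>p - p1. g (Sup K) - g (Inf K)) + (\<Sum>(t, K)\<in>p1. g (Sup K) - g (Inf K))"
      using \<open>p1 \<subseteq> p\<close> \<open>finite p\<close> by (rule sum.subset_diff)
    finally have split: "g b - g a = (\<Sum>(t, K)\<in>p - p1. g (Sup K) - g (Inf K))
        + (\<Sum>(t, K)\<in>p1. g (Sup K) - g (Inf K))" .
    have "(\<Sum>(t, K)\<in>p - p1. g (Sup K) - g (Inf K)) \<le> (\<Sum>(t, K)\<in>p - p1. e * (Sup K - Inf K))"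
    proof (rule sum_mono, clarify)
      fix t K assume tK: "(t, K) \<in> p" "(t, K) \<notin> p1"
      note el' = el[OF tK(1)]
      have "t \<notin> N" using tK by (auto simp: p1_def)
      then have R: "R t = ball t (\<rho> t)" using el'(5) by (simp add: R_def)
      have "Inf K \<in> K" "Sup K \<in> K" using el'(1-3) by (metis atLeastAtMost_iff order_refl order_trans)+
      then show "g (Sup K) - g (Inf K) \<le> e * (Sup K - Inf K)"
        using el' R \<open>t \<notin> N\<close> by (intro \<rho>(2)[of t]) auto
    qed
    also have "\<dots> \<le> (\<Sum>(t, K)\<in>p. e * (Sup K - Inf K))"
      using \<open>finite p\<close> \<open>e > 0\<close> el(2,3) by (intro sum_mono2) fastforce+
    also have "\<dots> = e * (\<Sum>(t, K)\<in>p. Sup K - Inf K)"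
      by (simp add: sum_distrib_left case_prod_unfold)
    also have "\<dots> = e * (b - a)"
      using additive_tagged_division_1[OF \<open>a \<le> b\<close> p(1), of "\<lambda>x. x"] by simp
    finally have part1: "(\<Sum>(t, K)\<in>p - p1. g (Sup K) - g (Inf K)) \<le> e * (b - a)" .
    have tp: "p1 tagged_partial_division_of {a..b}"
      using p(1) \<open>p1 \<subseteq> p\<close> tagged_partial_division_subset by (metis tagged_division_of_def)
    note un = tagged_partial_division_of_Union_self[OF tp]
    have dv: "snd ` p1 division_of \<Union>(snd ` p1)" by (rule division_of_tagged_division[OF un])
    have sub: "\<Union>(snd ` p1) \<subseteq> {a..b}" using el(6) \<open>p1 \<subseteq> p\<close> by fastforce
    have "(\<Sum>K\<in>snd ` p1. Sup K - Inf K) = (\<Sum>K\<in>snd ` p1. measure lebesgue K)"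
    proof (rule sum.cong[OF refl])
      fix K assume "K \<in> snd ` p1"
      then have "K = {Inf K..Sup K}" "Inf K \<le> Sup K" using division_endpoints(3,4)[OF dv sub] by blast+
      then show "Sup K - Inf K = measure lebesgue K"
        by (metis content_real measure_completion sets_lborel borel_closed closed_atLeastAtMost)
    qed
    also have "\<dots> = measure lebesgue (\<Union>(snd ` p1))" by (rule content_division[OF dv])
    also have "\<dots> \<le> measure lebesgue G"
    proof (rule measure_mono_fmeasurable[OF _ _ G(3)])
      show "\<Union>(snd ` p1) \<subseteq> G" using el(4) \<open>p1 \<subseteq> p\<close> by (fastforce simp: p1_def R_def)
      show "\<Union>(snd ` p1) \<in> sets lebesgue"
        using lmeasurable_division[OF dv] by (simp add: fmeasurableD)
    qed
    finally have small: "(\<Sum>K\<in>snd ` p1. norm (g (Sup K) - g (Inf K))) < e"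
      using \<delta>[OF dv sub] G(4) by simp
    \<comment> \<open>Replacing the sum over tagged pairs by a sum over intervals requires a summand
      that vanishes on every box without interior. The empty box is among them, and
      \<open>Sup\<close> and \<open>Inf\<close> of it are unspecified, hence the explicit 0.\<close>
    define F where "F K = (if K = {} then 0 else norm (g (Sup K) - g (Inf K)))" for K
    have F: "F K = norm (g (Sup K) - g (Inf K))" if "(t, K) \<in> p1" for t K
      using division_ofD(3)[OF dv, of K] that by (force simp: F_def)
    have "(\<Sum>(t, K)\<in>p1. g (Sup K) - g (Inf K)) \<le> (\<Sum>(t, K)\<in>p1. F K)"
      by (rule sum_mono) (auto simp: F)
    also have "\<dots> = (\<Sum>K\<in>snd ` p1. F K)"
    proof (rule sum.over_tagged_division_lemma[OF un])
      fix u v :: real assume "box u v = {}"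
      then show "F (cbox u v) = 0" by (cases "u = v") (auto simp: F_def)
    qed
    also have "\<dots> = (\<Sum>K\<in>snd ` p1. norm (g (Sup K) - g (Inf K)))"
      using F by (intro sum.cong) auto
    finally show ?thesis using small part1 split by linarith
  qed
  show ?thesis
  proof (rule field_le_epsilon)
    fix \<eta> :: real assume "\<eta> > 0"
    \<comment> \<open>For this value of \<open>e\<close> the bound \<open>e * (b - a) + e\<close> is
      exactly \<open>\<eta>\<close>; the added 1 avoids a division by 0 when
      \<open>a = b\<close>.\<close>
    have "g b - g a \<le> (\<eta> / (b - a + 1)) * (b - a) + \<eta> / (b - a + 1)"
      using main[of "\<eta> / (b - a + 1)"] \<open>\<eta> > 0\<close> \<open>a \<le> b\<close> by simp
    also have "\<dots> = \<eta>"
    proof -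
      have "\<eta> / (b - a + 1) * (b - a) + \<eta> / (b - a + 1) = \<eta> / (b - a + 1) * (b - a + 1)"
        by (simp only: distrib_left mult_1_right)
      then show ?thesis using \<open>a \<le> b\<close> by simp
    qed
    finally show "g b \<le> g a + \<eta>" by simp
  qed
qed

text \<open>Translating every interval of a division yields a division of the translate with the
  same lengths; distinct intervals stay distinct, so the sums can be reindexed.\<close>

lemma abs_continuous_on_shift:
  assumes "abs_continuous_on {a..b} x"
  shows "abs_continuous_on {a + s..b + s} (\<lambda>t. x (t - s))"
  unfolding abs_continuous_on_def
proof (intro allI impI)
  fix e :: real assume "e > 0"
  then obtain \<delta> where "\<delta> > 0" and \<delta>: "\<And>\<D> T. \<D> division_of T \<Longrightarrow> T \<subseteq> {a..b} \<Longrightarrow>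
      (\<Sum>K\<in>\<D>. Sup K - Inf K) < \<delta> \<Longrightarrow> (\<Sum>K\<in>\<D>. norm (x (Sup K) - x (Inf K))) < e"
    using assms unfolding abs_continuous_on_def by metis
  show "\<exists>\<delta>>0. \<forall>\<D> T. \<D> division_of T \<and> T \<subseteq> {a + s..b + s} \<and> (\<Sum>K\<in>\<D>. Sup K - Inf K) < \<delta> \<longrightarrow>
      (\<Sum>K\<in>\<D>. norm (x (Sup K - s) - x (Inf K - s))) < e"
  proof (intro exI[of _ \<delta>] conjI allI impI)
    fix \<D> T assume A: "\<D> division_of T \<and> T \<subseteq> {a + s..b + s} \<and> (\<Sum>K\<in>\<D>. Sup K - Inf K) < \<delta>"
    then have dv: "\<D> division_of T" by blast
    define sh where "sh K = (\<lambda>t. t - s) ` K" for K :: "real set"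
    have inj: "inj_on sh \<D>"
      unfolding sh_def by (rule inj_on_subset[OF inj_on_image[where A = "UNIV"]]) (auto simp: inj_on_def)
    have int: "interior (sh K) = sh (interior K)" for K
      unfolding sh_def using interior_translation[of "- s" K] by simp
    have Sh: "Sup (sh K) = Sup K - s" "Inf (sh K) = Inf K - s" if "K \<in> \<D>" for K
    proof -
      have K: "Inf K \<le> Sup K" "K = {Inf K..Sup K}"
        using division_endpoints(3,4)[OF dv order_refl that] .
      have "sh K = {Inf K - s..Sup K - s}"
        unfolding sh_def by (subst K(2)) (simp add: image_diff_atLeastAtMost)
      then show "Sup (sh K) = Sup K - s" "Inf (sh K) = Inf K - s" using K(1) by auto
    qed
    have "sh ` \<D> division_of sh T"
    proof (rule division_ofI)
      show "finite (sh ` \<D>)" using dv by auto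
      show "\<Union> (sh ` \<D>) = sh T"
        unfolding sh_def using division_ofD(6)[OF dv] by blast
      fix K' assume "K' \<in> sh ` \<D>"
      then obtain K where K: "K' = sh K" "K \<in> \<D>" by blast
      show "K' \<subseteq> sh T" "K' \<noteq> {}" using K division_ofD(2,3)[OF dv K(2)] by (auto simp: sh_def)
      obtain u v where "K = cbox u v" using division_ofD(4)[OF dv K(2)] by blast
      then have "K' = cbox (u - s) (v - s)" using K by (simp add: sh_def image_diff_atLeastAtMost)
      then show "\<exists>a b. K' = cbox a b" by blast
      fix L' assume "L' \<in> sh ` \<D>" "K' \<noteq> L'"
      then obtain L where L: "L' = sh L" "L \<in> \<D>" by blast
      have "interior K \<inter> interior L = {}"
        using division_ofD(5)[OF dv K(2) L(2)] K L \<open>K' \<noteq> L'\<close> by blast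
      then have "sh (interior K) \<inter> sh (interior L) = {}" unfolding sh_def by auto
      then show "interior K' \<inter> interior L' = {}" using K L int by simp
    qed
    moreover have "sh T \<subseteq> {a..b}" using A by (force simp: sh_def)
    moreover have "(\<Sum>K\<in>sh ` \<D>. Sup K - Inf K) = (\<Sum>K\<in>\<D>. Sup K - Inf K)"
      using Sh by (subst sum.reindex[OF inj]) simp
    moreover have "(\<Sum>K\<in>sh ` \<D>. norm (x (Sup K) - x (Inf K)))
        = (\<Sum>K\<in>\<D>. norm (x (Sup K - s) - x (Inf K - s)))"
      using Sh by (subst sum.reindex[OF inj]) simp
    ultimately show "(\<Sum>K\<in>\<D>. norm (x (Sup K - s) - x (Inf K - s))) < e"
      using \<delta>[of "sh ` \<D>" "sh T"] A by simp
  qed fact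
qed

section \<open>Uniqueness of solutions\<close>

lemma AE_lebesgue_on_iff:
  fixes I :: "real set"
  assumes "I \<in> sets lebesgue"
  shows "(AE t in lebesgue_on I. P t) \<longleftrightarrow> (AE t in lebesgue. t \<in> I \<longrightarrow> P t)"
  using assms by (intro AE_restrict_space_iff) simp

text \<open>Passing to \<open>lborel\<close> costs nothing, since a measure and its completion have
  the same almost everywhere statements, and Borel null sets are translation invariant.\<close>

lemma AE_lebesgue_shift:
  fixes s :: real
  assumes "AE t in lebesgue. P t"
  shows "AE t in lebesgue. P (t - s)"
proof -
  have "AE t in lborel. P t" using assms by (simp add: AE_completion_iff)
  then obtain N where N: "N \<in> null_sets lborel" "{t. \<not> P t} \<subseteq> N"
    by (auto simp: eventually_ae_filter)
  have "{t. t - s \<in> N} \<in> null_sets lborel" by (rule null_sets_translation[OF N(1)])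
  then have "AE t in lborel. P (t - s)"
    by (rule AE_I') (use N(2) in auto)
  then show ?thesis by (rule AE_completion)
qed

lemma solves_ode_ae_subset:
  assumes "solves_ode_ae g I x" "J \<subseteq> I" "I \<in> sets lebesgue" "J \<in> sets lebesgue"
  shows "solves_ode_ae g J x"
proof -
  have "AE t in lebesgue. t \<in> I \<longrightarrow> (x has_vector_derivative g t (x t)) (at t)"
    using assms(1,3) by (simp add: solves_ode_ae_def AE_lebesgue_on_iff)
  then have "AE t in lebesgue. t \<in> J \<longrightarrow> (x has_vector_derivative g t (x t)) (at t)"
    by eventually_elim (use assms(2) in blast)
  then show ?thesis
    using assms unfolding solves_ode_ae_def by (auto simp: AE_lebesgue_on_iff)
qed

lemma solves_ode_ae_shift:
  assumes "solves_ode_ae (\<lambda>t. g (t + s)) {a..<b} x"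
  shows "solves_ode_ae g {a + s..<b + s} (\<lambda>t. x (t - s))"
  unfolding solves_ode_ae_def
proof (intro conjI allI impI)
  fix u v assume "{u..v} \<subseteq> {a + s..<b + s}"
  then have "t \<in> {a..<b}" if "t \<in> {u - s..v - s}" for t
    using that subsetD[of "{u..v}" "{a + s..<b + s}" "t + s"] by auto
  then have "{u - s..v - s} \<subseteq> {a..<b}" by blast
  then have "abs_continuous_on {u - s..v - s} x" using assms by (simp add: solves_ode_ae_def)
  from abs_continuous_on_shift[OF this, of s]
  show "abs_continuous_on {u..v} (\<lambda>t. x (t - s))" by simp
next
  have "AE t in lebesgue. t \<in> {a..<b} \<longrightarrow> (x has_vector_derivative g (t + s) (x t)) (at t)"
    using assms by (simp add: solves_ode_ae_def AE_lebesgue_on_iff)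
  from AE_lebesgue_shift[OF this, of s]
  have "AE t in lebesgue. t \<in> {a + s..<b + s} \<longrightarrow>
      ((\<lambda>t. x (t - s)) has_vector_derivative g t (x (t - s))) (at t)"
  proof eventually_elim
    case (elim t)
    show ?case
    proof
      assume t: "t \<in> {a + s..<b + s}"
      then have *: "(x has_vector_derivative g t (x (t - s))) (at (t - s))" using elim by simp
      have "((\<lambda>t. t - s) has_vector_derivative 1) (at t)"
        by (auto intro!: derivative_eq_intros)
      from vector_diff_chain_at[OF this *]
      show "((\<lambda>t. x (t - s)) has_vector_derivative g t (x (t - s))) (at t)"
        by (simp add: o_def)
    qed
  qed
  then show "AE t in lebesgue_on {a + s..<b + s}.
      ((\<lambda>t. x (t - s)) has_vector_derivative g t (x (t - s))) (at t)"
    by (simp add: AE_lebesgue_on_iff)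
qed

text \<open>The derivative in \<open>solves_ode_ae\<close> is two-sided, so agreement on the
  half-open interval says nothing about it at the left endpoint \<open>a\<close>. This single point
  is discarded as a null set; every other point has a neighborhood on which \<open>x\<close> and
  \<open>y\<close> agree.\<close>

lemma solves_ode_ae_cong:
  assumes x: "solves_ode_ae g {a..<b} x" and eq: "\<And>t. t \<in> {a..<b} \<Longrightarrow> x t = y t"
  shows "solves_ode_ae g {a..<b} y"
  unfolding solves_ode_ae_def
proof (intro conjI allI impI)
  fix u v assume "{u..v} \<subseteq> {a..<b}"
  then show "abs_continuous_on {u..v} y"
    using x eq unfolding solves_ode_ae_def by (metis abs_continuous_on_cong subsetD)
next
  have "AE t in lebesgue. t \<in> {a..<b} \<longrightarrow> (x has_vector_derivative g t (x t)) (at t)"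
    using x by (simp add: solves_ode_ae_def AE_lebesgue_on_iff)
  moreover have "AE t in lebesgue. t \<noteq> a"
    by (rule AE_completion) (rule AE_lborel_singleton)
  ultimately have "AE t in lebesgue. t \<in> {a..<b} \<longrightarrow> (y has_vector_derivative g t (y t)) (at t)"
  proof eventually_elim
    case (elim t)
    show ?case
    proof
      assume t: "t \<in> {a..<b}"
      then have "(x has_vector_derivative g t (y t)) (at t)" using elim eq by auto
      then show "(y has_vector_derivative g t (y t)) (at t)"
        by (rule has_vector_derivative_transform_within_open[where S = "{a<..<b}"])
          (use t elim eq in auto)
    qed
  qed
  then show "AE t in lebesgue_on {a..<b}. (y has_vector_derivative g t (y t)) (at t)"
    by (simp add: AE_lebesgue_on_iff)
qed

text \<open>The function \<open>exp (- 2 * L * t) * |x t - y t|^2\<close> is absolutely continuous with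
  nonpositive derivative by the one-sided Lipschitz condition.\<close>

lemma H1_solution_unique:
  fixes f :: "real^'l \<Rightarrow> real^'n \<Rightarrow> real^'m \<Rightarrow> real^'n"
  assumes "H1 f D U" "v \<in> U" and d: "d ` {s..<s'} \<subseteq> D"
    and x: "solves_ode_ae (\<lambda>t z. f (d t) z v) {s..<s'} x"
    and y: "solves_ode_ae (\<lambda>t z. f (d t) z v) {s..<s'} y"
    and init: "x s = y s" and t: "t \<in> {s..<s'}"
  shows "x t = y t"
proof -
  have sub: "{s..t} \<subseteq> {s..<s'}" using t by auto
  have acx: "abs_continuous_on {s..t} x" and acy: "abs_continuous_on {s..t} y"
    using x y sub unfolding solves_ode_ae_def by blast+
  have "bounded (x ` {s..t})" "bounded (y ` {s..t})"
    using acx acy by (auto intro!: compact_imp_bounded compact_continuous_image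
        abs_continuous_on_imp_continuous_on)
  \<comment> \<open>The one-sided Lipschitz constant depends on a bounded set, so it is taken for
    one that contains both trajectories up to time \<open>t\<close>.\<close>
  then have "bounded ((x ` {s..t} \<union> y ` {s..t}) \<times> {v})" by (simp add: bounded_Times)
  moreover have "(x ` {s..t} \<union> y ` {s..t}) \<times> {v} \<subseteq> UNIV \<times> U" using \<open>v \<in> U\<close> by auto
  ultimately obtain L where "L \<ge> 0" and
    "\<forall>c\<in>D. \<forall>p q u. (p, u) \<in> (x ` {s..t} \<union> y ` {s..t}) \<times> {v} \<and>
      (q, u) \<in> (x ` {s..t} \<union> y ` {s..t}) \<times> {v} \<longrightarrow>
      (p - q) \<bullet> (f c p u - f c q u) \<le> L * (norm (p - q))\<^sup>2"
    using \<open>H1 f D U\<close> unfolding H1_def by metis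
  then have L: "(x \<tau> - y \<tau>) \<bullet> (f (d \<tau>) (x \<tau>) v - f (d \<tau>) (y \<tau>) v) \<le> L * (norm (x \<tau> - y \<tau>))\<^sup>2"
    if "\<tau> \<in> {s..t}" for \<tau>
    using that d sub by blast
  define z where "z \<tau> = x \<tau> - y \<tau>" for \<tau>
  define E where "E \<tau> = exp (- 2 * L * \<tau>)" for \<tau> :: real
  define w where "w \<tau> = (z \<tau> \<bullet> z \<tau>) * E \<tau>" for \<tau>
  have dE: "(E has_real_derivative - 2 * L * E \<tau>) (at \<tau> within X)" for \<tau> X
    unfolding E_def by (auto intro!: derivative_eq_intros)
  have acE: "abs_continuous_on {s..t} E"
  \<comment> \<open>\<open>E\<close> is nonincreasing, so on \<open>{s..t}\<close> its derivative is
    largest in modulus at the left end.\<close>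
  proof (rule abs_continuous_on_lipschitz[of "2 * L * E s"])
    show "0 \<le> 2 * L * E s" using \<open>L \<ge> 0\<close> by (simp add: E_def)
    fix u v assume uv: "u \<in> {s..t}" "v \<in> {s..t}" "u \<le> v"
    have "norm (E v - E u) \<le> 2 * L * E s * norm (v - u)"
    proof (rule field_differentiable_bound[where S = "{s..t}" and f' = "\<lambda>\<tau>. - 2 * L * E \<tau>"])
      fix \<tau> assume "\<tau> \<in> {s..t}"
      then have "E \<tau> \<le> E s" using \<open>L \<ge> 0\<close> by (simp add: E_def mult_left_mono)
      then show "norm (- 2 * L * E \<tau>) \<le> 2 * L * E s"
        using \<open>L \<ge> 0\<close> by (simp add: abs_mult mult_left_mono E_def)
    qed (use uv dE in auto)
    then show "norm (E v - E u) \<le> 2 * L * E s * (v - u)" using uv by simp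
  qed
  have acw: "abs_continuous_on {s..t} w"
    unfolding w_def z_def
    by (intro abs_continuous_on_bilinear[OF bounded_bilinear_mult] acE
        abs_continuous_on_bilinear[OF bounded_bilinear_inner] abs_continuous_on_diff acx acy)
  have "AE \<tau> in lebesgue. \<tau> \<in> {s..<s'} \<longrightarrow> (x has_vector_derivative f (d \<tau>) (x \<tau>) v) (at \<tau>)"
    "AE \<tau> in lebesgue. \<tau> \<in> {s..<s'} \<longrightarrow> (y has_vector_derivative f (d \<tau>) (y \<tau>) v) (at \<tau>)"
    using x y by (simp_all add: solves_ode_ae_def AE_lebesgue_on_iff)
  then have "AE \<tau> in lebesgue. \<tau> \<in> {s..<s'} \<longrightarrow> (x has_vector_derivative f (d \<tau>) (x \<tau>) v) (at \<tau>)
      \<and> (y has_vector_derivative f (d \<tau>) (y \<tau>) v) (at \<tau>)"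
    by eventually_elim blast
  then obtain N where N: "N \<in> null_sets lebesgue" and
    der: "\<And>\<tau>. \<tau> \<in> {s..<s'} - N \<Longrightarrow> (x has_vector_derivative f (d \<tau>) (x \<tau>) v) (at \<tau>)
      \<and> (y has_vector_derivative f (d \<tau>) (y \<tau>) v) (at \<tau>)"
    by (auto simp: eventually_ae_filter subset_iff)
  have "w t \<le> w s"
  proof (rule abs_continuous_AE_deriv_nonpos[OF acw _ N])
    fix \<tau> assume \<tau>: "\<tau> \<in> {s..t} - N"
    let ?z' = "f (d \<tau>) (x \<tau>) v - f (d \<tau>) (y \<tau>) v"
    have "(z has_vector_derivative ?z') (at \<tau>)"
      unfolding z_def using der[of \<tau>] \<tau> sub by (intro has_vector_derivative_diff) auto
    from bounded_bilinear.has_vector_derivative[OF bounded_bilinear_inner this this]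
    have "((\<lambda>\<tau>. z \<tau> \<bullet> z \<tau>) has_vector_derivative 2 * (z \<tau> \<bullet> ?z')) (at \<tau>)"
      by (simp add: inner_commute)
    from bounded_bilinear.has_vector_derivative[OF bounded_bilinear_mult this
        dE[of \<tau> UNIV, unfolded has_real_derivative_iff_has_vector_derivative]]
    have "(w has_vector_derivative (z \<tau> \<bullet> z \<tau>) * (- 2 * L * E \<tau>) + 2 * (z \<tau> \<bullet> ?z') * E \<tau>) (at \<tau>)"
      unfolding w_def .
    moreover have "(z \<tau> \<bullet> z \<tau>) * (- 2 * L * E \<tau>) + 2 * (z \<tau> \<bullet> ?z') * E \<tau> \<le> 0"
    proof -
      have "(z \<tau> \<bullet> ?z') * E \<tau> \<le> (L * (norm (z \<tau>))\<^sup>2) * E \<tau>"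
        using L[of \<tau>] \<tau> by (intro mult_right_mono) (auto simp: z_def E_def)
      then show ?thesis by (simp add: power2_norm_eq_inner algebra_simps)
    qed
    ultimately show "\<exists>c\<le>0. (w has_vector_derivative c) (at \<tau>)" by blast
  qed (use t in auto)
  also have "w s = 0" using init by (simp add: w_def z_def)
  finally have "z t \<bullet> z t \<le> 0" by (simp add: w_def E_def mult_le_0_iff)
  then have "z t = 0" using inner_ge_zero[of "z t"] by simp
  then show ?thesis by (simp add: z_def)
qed

section \<open>Sampled-data solutions\<close>

text \<open>Extension by 0 makes \<open>g\<close> measurable on the whole line, where translation is
  Lebesgue measurable. A shift by \<open>s \<ge> 0\<close> maps the half line into itself, so the
  filler value is never seen.\<close>

lemma lebesgue_measurable_shift:
  fixes g :: "real \<Rightarrow> 'a::euclidean_space"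
  assumes g: "g \<in> borel_measurable (lebesgue_on {0..})" and "s \<ge> 0"
  shows "(\<lambda>t. g (t + s)) \<in> borel_measurable (lebesgue_on {0..})"
proof -
  have "(\<lambda>t. if t \<in> {0..} then g t else 0) \<in> borel_measurable lebesgue"
    using g by (subst borel_measurable_if) auto
  moreover have "(\<lambda>t. s + t) \<in> lebesgue \<rightarrow>\<^sub>M lebesgue"
    using lebesgue_affine_measurable[of "\<lambda>_. 1" s] by simp
  ultimately have "(\<lambda>t. if s + t \<in> {0..} then g (s + t) else 0) \<in> borel_measurable lebesgue"
    by (rule measurable_compose_rev)
  then have "(\<lambda>t. if s + t \<in> {0..} then g (s + t) else 0) \<in> borel_measurable (lebesgue_on {0..})"
    by (rule measurable_restrict_space1)
  moreover have "(if s + t \<in> {0..} then g (s + t) else 0) = g (t + s)"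
    if "t \<in> space (lebesgue_on {0..})" for t
    using that \<open>s \<ge> 0\<close> by (simp add: space_restrict_space add.commute)
  ultimately show ?thesis by (subst measurable_cong[symmetric]) auto
qed

text \<open>What follows a sampling instant is again a sampled-data solution, for the shifted
  disturbance and perturbation. This lemma and its counterpart for perturbations keep these
  admissible.\<close>

lemma L_infinity_loc_shift:
  assumes "d \<in> L_infinity_loc D" "s \<ge> 0"
  shows "(\<lambda>t. d (t + s)) \<in> L_infinity_loc D"
  unfolding L_infinity_loc_def
proof (intro CollectI conjI allI impI)
  show "(\<lambda>t. d (t + s)) ` {0..} \<subseteq> D" using assms by (auto simp: L_infinity_loc_def)
  show "(\<lambda>t. d (t + s)) \<in> borel_measurable (lebesgue_on {0..})"
    using assms by (intro lebesgue_measurable_shift) (auto simp: L_infinity_loc_def)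
  fix K :: "real set" assume K: "compact K \<and> K \<subseteq> {0..}"
  have "compact ((+) s ` K)" "(+) s ` K \<subseteq> {0..}"
    using K \<open>s \<ge> 0\<close> by (auto intro: compact_translation)
  then obtain M where "AE t in lebesgue_on ((+) s ` K). norm (d t) \<le> M"
    using assms(1) unfolding L_infinity_loc_def by blast
  moreover have KL: "K \<in> sets lebesgue" "(+) s ` K \<in> sets lebesgue"
    using K \<open>compact ((+) s ` K)\<close> by (auto dest: lmeasurable_compact fmeasurableD)
  ultimately have "AE t in lebesgue. t \<in> (+) s ` K \<longrightarrow> norm (d t) \<le> M"
    by (simp add: AE_lebesgue_on_iff)
  from AE_lebesgue_shift[OF this, of "- s"]
  have "AE t in lebesgue. t \<in> K \<longrightarrow> norm (d (t + s)) \<le> M"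
    by eventually_elim (auto simp: add.commute)
  then show "\<exists>M. AE t in lebesgue_on K. norm (d (t + s)) \<le> M"
    using KL by (auto simp: AE_lebesgue_on_iff)
qed

lemma sampling_perturbations_shift:
  assumes "e \<in> sampling_perturbations" "s \<ge> 0"
  shows "(\<lambda>t. e (t + s)) \<in> sampling_perturbations"
  unfolding sampling_perturbations_def locally_bounded_on_def
proof (intro CollectI conjI allI impI)
  show "(\<lambda>t. e (t + s)) ` {0..} \<subseteq> {0..}"
    using assms by (simp add: sampling_perturbations_def image_subset_iff)
  show "(\<lambda>t. e (t + s)) \<in> borel_measurable (lebesgue_on {0..})"
    using assms by (intro lebesgue_measurable_shift) (auto simp: sampling_perturbations_def)
  fix K :: "real set" assume K: "compact K \<and> K \<subseteq> {0..}"
  have "compact ((+) s ` K)" "(+) s ` K \<subseteq> {0..}"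
    using K \<open>s \<ge> 0\<close> by (auto intro: compact_translation)
  then have "bounded (e ` ((+) s ` K))"
    using assms(1) unfolding sampling_perturbations_def locally_bounded_on_def by blast
  then show "bounded ((\<lambda>t. e (t + s)) ` K)" by (simp add: image_image add.commute)
qed

lemma sampling_perturbations_add_const:
  assumes "e \<in> sampling_perturbations" "c \<ge> 0"
  shows "(\<lambda>t. e t + c) \<in> sampling_perturbations"
proof -
  have "bounded ((\<lambda>t. e t + c) ` K)" if "bounded (e ` K)" for K
    using bounded_translation[OF that, of c] by (simp add: image_image add.commute)
  then show ?thesis
    using assms by (auto simp: sampling_perturbations_def locally_bounded_on_def image_subset_iff)
qed

section \<open>The grid of sampling instants\<close>

lemma sampling_time_less_Suc: "h > 0 \<Longrightarrow> sampling_time h e i < sampling_time h e (Suc i)"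
  by simp

lemma sampling_time_mono:
  assumes "h > 0" "i \<le> j"
  shows "sampling_time h e i \<le> sampling_time h e j"
  using assms lift_Suc_mono_le[of "sampling_time h e" i j] by simp

lemma sampling_time_nonneg: "h > 0 \<Longrightarrow> 0 \<le> sampling_time h e i"
  using sampling_time_mono[of h 0 i e] by simp

text \<open>If all instants stayed below \<open>B\<close>, a bound \<open>M\<close> for
  \<open>e\<close> on \<open>{0..B}\<close> would make every step at least
  \<open>h * exp (- M)\<close>, a contradiction. Hence sampling instants do not accumulate and the
  pieces of a solution fill the half line.\<close>

lemma sampling_time_unbounded:
  assumes "h > 0" "e \<in> sampling_perturbations"
  shows "\<exists>i. B < sampling_time h e i"
proof (rule ccontr)
  assume "\<nexists>i. B < sampling_time h e i"
  then have le: "sampling_time h e i \<le> B" for i by (meson not_less)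
  have "bounded (e ` {0..B})"
    using assms(2) unfolding sampling_perturbations_def locally_bounded_on_def by auto
  then obtain M where "\<forall>t\<in>{0..B}. \<bar>e t\<bar> \<le> M" unfolding bounded_iff by auto
  then have M: "e t \<le> M" if "t \<in> {0..B}" for t using that by fastforce
  have "h * exp (- M) * real i \<le> sampling_time h e i" for i
  proof (induction i)
    case (Suc i)
    have "e (sampling_time h e i) \<le> M" using le sampling_time_nonneg[OF \<open>h > 0\<close>] by (intro M) simp
    then have "h * exp (- M) \<le> h * exp (- e (sampling_time h e i))" using \<open>h > 0\<close> by simp
    with Suc show ?case by (simp add: algebra_simps)
  qed simp
  with le have "h * exp (- M) * real i \<le> B" for i by (meson order_trans)
  moreover obtain n where "real n > B / (h * exp (- M))" using reals_Archimedean2 by blast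
  ultimately show False using \<open>h > 0\<close> by (simp add: pos_divide_less_eq mult.commute not_less[symmetric])
qed

lemma sampling_time_interval:
  assumes "h > 0" "e \<in> sampling_perturbations" "0 \<le> t"
  obtains i where "sampling_time h e i \<le> t" "t < sampling_time h e (Suc i)"
proof -
  define j where "j = (LEAST j. t < sampling_time h e j)"
  have j: "t < sampling_time h e j"
    unfolding j_def using sampling_time_unbounded[OF assms(1,2)] by (rule LeastI_ex)
  then have "j \<noteq> 0" using \<open>0 \<le> t\<close> by (metis sampling_time.simps(1) not_less)
  then obtain i where i: "j = Suc i" using not0_implies_Suc by blast
  have "\<not> t < sampling_time h e i"
    using not_less_Least[of i "\<lambda>j. t < sampling_time h e j"] i unfolding j_def by simp
  with that i j show thesis by (metis not_less)
qed

lemma sampling_time_shift: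
  "sampling_time h (\<lambda>t. e (t + sampling_time h e m)) i + sampling_time h e m
     = sampling_time h e (i + m)"
  by (induction i) (simp_all add: algebra_simps)

lemma sampling_time_rescale:
  assumes "h > 0" "h1 > 0"
  shows "sampling_time h1 (\<lambda>t. e t + ln (h1 / h)) i = sampling_time h e i"
proof (induction i)
  case (Suc i)
  have "h1 * exp (- (c + ln (h1 / h))) = h * exp (- c)" for c
    using assms by (simp add: exp_diff exp_minus divide_simps flip: minus_add_distrib)
      (simp add: exp_add)
  with Suc show ?case by simp
qed simp

text \<open>Agreement travels along the grid: equal states at one instant give the same held
  control, hence equal trajectories up to the next instant, and the left limits that determine the
  next state coincide.\<close>

lemma sampled_data_solution_unique:
  fixes f :: "real^'l \<Rightarrow> real^'n \<Rightarrow> real^'m \<Rightarrow> real^'n"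
  assumes "H1 f D U" "range k \<subseteq> U" "h > 0" and d: "d ` {0..} \<subseteq> D"
    and e: "e \<in> sampling_perturbations"
    and x: "sampled_data_solution f k h d e x0 x" and y: "sampled_data_solution f k h d e x0 y"
    and "t \<ge> 0"
  shows "x t = y t"
proof -
  let ?\<tau> = "sampling_time h e"
  have piece: "x t = y t" if "x (?\<tau> i) = y (?\<tau> i)" "t \<in> {?\<tau> i..<?\<tau> (Suc i)}" for i t
  proof (rule H1_solution_unique[where v = "k (x (?\<tau> i))", OF assms(1)])
    show "x (?\<tau> i) = y (?\<tau> i)" "t \<in> {?\<tau> i..<?\<tau> (Suc i)}" by fact+
    show "k (x (?\<tau> i)) \<in> U" using assms(2) by auto
    show "d ` {?\<tau> i..<?\<tau> (Suc i)} \<subseteq> D"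
      using d sampling_time_nonneg[OF \<open>h > 0\<close>, of e i] by (auto simp: image_subset_iff)
    show "solves_ode_ae (\<lambda>t z. f (d t) z (k (x (?\<tau> i)))) {?\<tau> i..<?\<tau> (Suc i)} x"
      using x unfolding sampled_data_solution_def Let_def by blast
    show "solves_ode_ae (\<lambda>t z. f (d t) z (k (x (?\<tau> i)))) {?\<tau> i..<?\<tau> (Suc i)} y"
      using y that(1) unfolding sampled_data_solution_def Let_def by simp
  qed
  have grid: "x (?\<tau> i) = y (?\<tau> i)" for i
  proof (induction i)
    case 0
    then show ?case using x y by (simp add: sampled_data_solution_def)
  next
    case (Suc i)
    have lt: "?\<tau> i < ?\<tau> (Suc i)" using sampling_time_less_Suc[OF \<open>h > 0\<close>] .
    have "(x \<longlongrightarrow> x (?\<tau> (Suc i))) (at_left (?\<tau> (Suc i)))"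
      "(y \<longlongrightarrow> y (?\<tau> (Suc i))) (at_left (?\<tau> (Suc i)))"
      using x y unfolding sampled_data_solution_def Let_def by blast+
    moreover have "eventually (\<lambda>t. y t = x t) (at_left (?\<tau> (Suc i)))"
      using eventually_at_left_real[OF lt] by eventually_elim (use piece[OF Suc] in auto)
    ultimately have "(x \<longlongrightarrow> y (?\<tau> (Suc i))) (at_left (?\<tau> (Suc i)))"
      using tendsto_cong by blast
    with \<open>(x \<longlongrightarrow> x (?\<tau> (Suc i))) _\<close> show ?case
      using tendsto_unique trivial_limit_at_left_real by blast
  qed
  obtain i where "?\<tau> i \<le> t" "t < ?\<tau> (Suc i)"
    using sampling_time_interval[OF \<open>h > 0\<close> e \<open>t \<ge> 0\<close>] .
  then show ?thesis using piece[OF grid] by auto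
qed

text \<open>The gluing time is a sampling instant: the control is recomputed there anyway, and the
  shifted grid is the tail of the original one. \<open>y\<close> has to follow the feedback on the
  first \<open>m\<close> intervals only, so a trajectory with constant control qualifies as long as
  the sampled feedback equals that constant.\<close>

lemma sampled_data_solution_concat:
  assumes "h > 0"
    and y: "\<And>i. i < m \<Longrightarrow> solves_ode_ae (\<lambda>t z. f (d t) z (k (y (sampling_time h e i))))
        {sampling_time h e i..<sampling_time h e (Suc i)} y"
      "\<And>i. i < m \<Longrightarrow> (y \<longlongrightarrow> y (sampling_time h e (Suc i))) (at_left (sampling_time h e (Suc i)))"
    and z: "sampled_data_solution f k h (\<lambda>t. d (t + sampling_time h e m))
        (\<lambda>t. e (t + sampling_time h e m)) (y (sampling_time h e m)) z"
  shows "sampled_data_solution f k h d e (y 0)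
    (\<lambda>t. if t < sampling_time h e m then y t else z (t - sampling_time h e m))"
proof -
  let ?\<tau> = "sampling_time h e"
  define s where "s = ?\<tau> m"
  define x where "x t = (if t < s then y t else z (t - s))" for t
  have z0: "z 0 = y s" using z by (simp add: sampled_data_solution_def s_def)
  \<comment> \<open>At \<open>s\<close> itself the second branch of \<open>x\<close> applies;
    \<open>z 0 = y s\<close> extends the agreement with \<open>y\<close> to this point, as the left
    limit at \<open>s\<close> requires.\<close>
  have xs: "x t = y t" if "t \<le> s" for t using that z0 by (cases "t = s") (auto simp: x_def)
  have "solves_ode_ae (\<lambda>t z. f (d t) z (k (x (?\<tau> i)))) {?\<tau> i..<?\<tau> (Suc i)} x
      \<and> (x \<longlongrightarrow> x (?\<tau> (Suc i))) (at_left (?\<tau> (Suc i)))" for i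
  proof (cases "i < m")
    case True
    then have le: "?\<tau> (Suc i) \<le> s" "?\<tau> i \<le> s"
      unfolding s_def by (auto intro!: sampling_time_mono[OF \<open>h > 0\<close>] simp del: sampling_time.simps)
    have lt: "?\<tau> i < ?\<tau> (Suc i)" using sampling_time_less_Suc[OF \<open>h > 0\<close>] .
    have "solves_ode_ae (\<lambda>t z. f (d t) z (k (x (?\<tau> i)))) {?\<tau> i..<?\<tau> (Suc i)} x"
      by (rule solves_ode_ae_cong[of _ _ _ y]) (use y(1)[OF True] le xs in \<open>auto simp del: sampling_time.simps\<close>)
    moreover have "eventually (\<lambda>t. y t = x t) (at_left (?\<tau> (Suc i)))"
      using eventually_at_left_real[OF lt] by eventually_elim (use le xs in auto)
    then have "(x \<longlongrightarrow> y (?\<tau> (Suc i))) (at_left (?\<tau> (Suc i)))"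
      using y(2)[OF True] tendsto_cong by blast
    ultimately show ?thesis using xs[OF le(1)] by simp
  next
    case False
    then obtain j where j: "i = j + m" by (metis add.commute le_add_diff_inverse not_less)
    define e' where "e' = (\<lambda>t. e (t + s))"
    have \<tau>: "?\<tau> i = sampling_time h e' j + s" "?\<tau> (Suc i) = sampling_time h e' (Suc j) + s"
      using sampling_time_shift[of h e m j] sampling_time_shift[of h e m "Suc j"] j
      unfolding s_def e'_def by auto
    have nn: "0 \<le> sampling_time h e' j" "0 \<le> sampling_time h e' (Suc j)"
      by (rule sampling_time_nonneg[OF \<open>h > 0\<close>])+
    have lt: "sampling_time h e' j < sampling_time h e' (Suc j)" using sampling_time_less_Suc[OF \<open>h > 0\<close>] .
    have zj: "solves_ode_ae (\<lambda>t w. f (d (t + s)) w (k (z (sampling_time h e' j))))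
        {sampling_time h e' j..<sampling_time h e' (Suc j)} z"
      "(z \<longlongrightarrow> z (sampling_time h e' (Suc j))) (at_left (sampling_time h e' (Suc j)))"
      using z unfolding sampled_data_solution_def Let_def s_def e'_def by blast+
    have xt: "x t = z (t - s)" if "?\<tau> i \<le> t" for t
    proof -
      have "\<not> t < s" using that nn(1) \<tau>(1) by linarith
      then show ?thesis by (simp add: x_def)
    qed
    have xi: "x (?\<tau> i) = z (sampling_time h e' j)" "x (?\<tau> (Suc i)) = z (sampling_time h e' (Suc j))"
      using nn unfolding \<tau> by (auto simp: x_def)
    from solves_ode_ae_shift[OF zj(1)]
    have "solves_ode_ae (\<lambda>t w. f (d t) w (k (z (sampling_time h e' j)))) {?\<tau> i..<?\<tau> (Suc i)} (\<lambda>t. z (t - s))"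
      unfolding \<tau> .
    then have "solves_ode_ae (\<lambda>t w. f (d t) w (k (x (?\<tau> i)))) {?\<tau> i..<?\<tau> (Suc i)} x"
      unfolding xi by (rule solves_ode_ae_cong) (simp add: xt)
    moreover have "((\<lambda>t. z (t - s)) \<longlongrightarrow> z (sampling_time h e' (Suc j))) (at_left (?\<tau> (Suc i)))"
    proof (rule filterlim_compose[OF zj(2)])
      show "filterlim (\<lambda>t. t - s) (at_left (sampling_time h e' (Suc j))) (at_left (?\<tau> (Suc i)))"
        unfolding \<tau>(2) filterlim_at
        by (auto intro!: tendsto_eq_intros simp: eventually_at_filter simp del: sampling_time.simps)
    qed
    then have "(x \<longlongrightarrow> x (?\<tau> (Suc i))) (at_left (?\<tau> (Suc i)))"
    proof -
      assume *: "((\<lambda>t. z (t - s)) \<longlongrightarrow> z (sampling_time h e' (Suc j))) (at_left (?\<tau> (Suc i)))"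
      have "?\<tau> i < ?\<tau> (Suc i)" using sampling_time_less_Suc[OF \<open>h > 0\<close>] .
      from eventually_at_left_real[OF this]
      have ev: "eventually (\<lambda>t. z (t - s) = x t) (at_left (?\<tau> (Suc i)))"
        by eventually_elim (simp add: xt)
      show ?thesis unfolding xi by (rule iffD1[OF tendsto_cong[OF ev] *])
    qed
    ultimately show ?thesis by blast
  qed
  moreover have "x 0 = y 0" using xs sampling_time_nonneg[OF \<open>h > 0\<close>, of e m] by (simp add: s_def)
  ultimately have "sampled_data_solution f k h d e (y 0) x"
    by (simp add: sampled_data_solution_def Let_def)
  then show ?thesis unfolding x_def[abs_def] s_def .
qed

section \<open>Comparison functions\<close>

text \<open>\<open>P\<close> is a locally finite sum of ramps; the \<open>i\<close>-th climbs from 0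
  at \<open>i - 2\<close> to the modulus of \<open>c i\<close> at \<open>i - 1\<close>. If
  \<open>s\<close> rounds up to \<open>i\<close>, then \<open>s\<close> exceeds \<open>i - 1\<close>
  and this ramp is already full. Constants found separately for each integer radius thus become
  comparison functions.\<close>

lemma continuous_mono_majorant:
  fixes c :: "nat \<Rightarrow> real"
  shows "\<exists>P :: real \<Rightarrow> real. continuous_on {0..} P \<and> mono_on {0..} P \<and> (\<forall>s\<ge>0. 0 \<le> P s \<and> c (nat \<lceil>s\<rceil>) \<le> P s)"
proof -
  define \<phi> :: "nat \<Rightarrow> real \<Rightarrow> real" where "\<phi> i s = \<bar>c i\<bar> * max 0 (min 1 (s + 2 - real i))" for i s
  \<comment> \<open>Ramps with \<open>i \<ge> s + 2\<close> vanish, which explains the cutoff. By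
    \<open>P_eq\<close> one finite sum then serves for all \<open>s \<le> n\<close>, and continuity
    and monotonicity follow from those of its terms.\<close>
  define P :: "real \<Rightarrow> real" where "P s = (\<Sum>i<nat \<lceil>s\<rceil> + 2. \<phi> i s)" for s
  have \<phi>_nonneg: "0 \<le> \<phi> i s" for i s by (simp add: \<phi>_def)
  have \<phi>_mono: "\<phi> i s \<le> \<phi> i t" if "s \<le> t" for i s t
    unfolding \<phi>_def using that by (intro mult_left_mono) auto
  have P_eq: "P s = (\<Sum>i<n + 2. \<phi> i s)" if "s \<le> real n" for s n
    unfolding P_def
  proof (rule sum.mono_neutral_left)
    show "{..<nat \<lceil>s\<rceil> + 2} \<subseteq> {..<n + 2}" using that by (auto simp: ceiling_le_iff nat_le_iff)
    show "\<forall>i\<in>{..<n + 2} - {..<nat \<lceil>s\<rceil> + 2}. \<phi> i s = 0"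
    proof
      fix i assume "i \<in> {..<n + 2} - {..<nat \<lceil>s\<rceil> + 2}"
      then have "nat \<lceil>s\<rceil> + 2 \<le> i" by simp
      then have "s + 2 - real i \<le> 0" by linarith
      then show "\<phi> i s = 0" by (simp add: \<phi>_def)
    qed
  qed simp
  have "isCont P s" for s
  proof -
    obtain n where n: "s < real n" using reals_Archimedean2 by blast
    have "continuous_on {..<real n} (\<lambda>s. \<Sum>i<n + 2. \<phi> i s)"
      unfolding \<phi>_def by (intro continuous_intros)
    then have "continuous_on {..<real n} P"
      using P_eq by (subst continuous_on_cong[OF refl, where g = "\<lambda>s. \<Sum>i<n + 2. \<phi> i s"]) auto
    then show ?thesis using n by (simp add: continuous_on_eq_continuous_at)
  qed
  then have "continuous_on {0..} P" by (simp add: continuous_at_imp_continuous_on)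
  moreover have "mono_on {0..} P"
  proof (rule mono_onI)
    fix s t :: real assume "s \<le> t"
    moreover obtain n where "t < real n" using reals_Archimedean2 by blast
    ultimately have "P s = (\<Sum>i<n + 2. \<phi> i s)" "P t = (\<Sum>i<n + 2. \<phi> i t)" by (simp_all only: P_eq)
    then show "P s \<le> P t" by (simp only: sum_mono \<phi>_mono[OF \<open>s \<le> t\<close>])
  qed
  moreover have "0 \<le> P s" if "0 \<le> s" for s unfolding P_def by (intro sum_nonneg \<phi>_nonneg)
  moreover have "c (nat \<lceil>s\<rceil>) \<le> P s" if "0 \<le> s" for s
  proof -
    have "real (nat \<lceil>s\<rceil>) \<le> s + 1" using that by linarith
    then have "\<phi> (nat \<lceil>s\<rceil>) s = \<bar>c (nat \<lceil>s\<rceil>)\<bar>" by (simp add: \<phi>_def)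
    then have "c (nat \<lceil>s\<rceil>) \<le> \<phi> (nat \<lceil>s\<rceil>) s" by simp
    also have "\<dots> \<le> P s" unfolding P_def by (rule member_le_sum) (auto simp: \<phi>_nonneg)
    finally show ?thesis .
  qed
  ultimately show ?thesis by (intro exI[of _ P]) simp
qed

lemma class_K_nonneg: "class_K \<gamma> \<Longrightarrow> 0 \<le> s \<Longrightarrow> 0 \<le> \<gamma> s"
  unfolding class_K_def by auto

lemma class_K_mono: "class_K \<gamma> \<Longrightarrow> 0 \<le> s \<Longrightarrow> s \<le> t \<Longrightarrow> \<gamma> s \<le> \<gamma> t"
  unfolding class_K_def by (meson atLeast_iff order_trans strict_mono_on_leD)

lemma class_K_strict_mono: "class_K \<gamma> \<Longrightarrow> 0 \<le> s \<Longrightarrow> s < t \<Longrightarrow> \<gamma> s < \<gamma> t"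
  unfolding class_K_def strict_mono_on_def by auto

lemma class_KL_class_K: "class_KL \<sigma> \<Longrightarrow> 0 \<le> t \<Longrightarrow> class_K (\<lambda>s. \<sigma> s t)"
  unfolding class_KL_def by blast

lemma class_KL_antimono: "class_KL \<sigma> \<Longrightarrow> 0 \<le> s \<Longrightarrow> 0 \<le> t \<Longrightarrow> t \<le> t' \<Longrightarrow> \<sigma> s t' \<le> \<sigma> s t"
  unfolding class_KL_def monotone_on_def by (meson atLeast_iff order_trans)

lemma class_KI:
  assumes "continuous_on {0..} \<gamma>" "\<And>s t. 0 \<le> s \<Longrightarrow> s < t \<Longrightarrow> \<gamma> s < \<gamma> t" "\<gamma> 0 = 0"
  shows "class_K \<gamma>"
proof -
  have "0 \<le> \<gamma> s" if "0 \<le> s" for s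
    using assms(2)[of 0 s] assms(3) that by (cases "s = 0") auto
  then show ?thesis using assms by (auto simp: class_K_def strict_mono_on_def)
qed

text \<open>Strict growth in \<open>s\<close> comes from the first summand. The second only has to
  be nondecreasing in \<open>s\<close>: \<open>\<phi>\<close> grows and a longer delay
  \<open>T s\<close> means an earlier, hence larger, value of \<open>\<sigma> C\<close>. The
  \<open>max\<close> freezes it at \<open>\<sigma> C 0\<close> until the delay is over.\<close>

lemma class_KL_add_delayed:
  assumes \<sigma>: "class_KL \<sigma>" and "0 \<le> C"
    and \<phi>: "continuous_on {0..} \<phi>" "mono_on {0..} \<phi>" "\<phi> 0 = 0"
    and T: "continuous_on {0..} T" "mono_on {0..} T"
  shows "class_KL (\<lambda>s t. \<sigma> s t + \<phi> s * \<sigma> C (max 0 (t - T s)))"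
proof -
  have cont: "continuous_on ({0..} \<times> {0..}) (\<lambda>(s, t). \<sigma> s t)" using \<sigma> by (simp add: class_KL_def)
  have \<phi>_nonneg: "0 \<le> \<phi> s" if "0 \<le> s" for s
    using mono_onD[OF \<phi>(2), of 0 s] \<phi>(3) that by simp
  have \<sigma>_nonneg: "0 \<le> \<sigma> C t" if "0 \<le> t" for t
    using class_K_nonneg[OF class_KL_class_K[OF \<sigma> that] \<open>0 \<le> C\<close>] .
  have cont': "continuous_on ({0..} \<times> {0..}) (\<lambda>p. \<sigma> (fst p) (snd p) +
      \<phi> (fst p) * \<sigma> C (max 0 (snd p - T (fst p))))"
  proof (intro continuous_intros)
    show "continuous_on ({0..} \<times> {0..}) (\<lambda>p. \<sigma> (fst p) (snd p))"
      using cont by (simp add: case_prod_unfold)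
    show "continuous_on ({0..} \<times> {0..}) (\<lambda>p. \<phi> (fst p))"
      by (rule continuous_on_compose2[OF \<phi>(1)]) (auto intro: continuous_intros)
    have "continuous_on ({0..} \<times> {0..}) (\<lambda>p. T (fst p))"
      by (rule continuous_on_compose2[OF T(1)]) (auto intro: continuous_intros)
    then have pair: "continuous_on ({0..} \<times> {0..}) (\<lambda>p. (C, max 0 (snd p - T (fst p))))"
      by (intro continuous_intros)
    have "(\<lambda>p. (C, max 0 (snd p - T (fst p)))) ` ({0..} \<times> {0..}) \<subseteq> {0..} \<times> {0..}"
      using \<open>0 \<le> C\<close> by auto
    from continuous_on_compose2[OF cont pair this]
    show "continuous_on ({0..} \<times> {0..}) (\<lambda>p. \<sigma> C (max 0 (snd p - T (fst p))))" by simp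
  qed
  have "class_K (\<lambda>s. \<sigma> s t + \<phi> s * \<sigma> C (max 0 (t - T s)))" if "0 \<le> t" for t
  proof (rule class_KI)
    have "continuous_on {0..} (\<lambda>s. (s, t))" by (intro continuous_intros)
    moreover have "(\<lambda>s. (s, t)) ` {0..} \<subseteq> {0..} \<times> {0..}" using that by auto
    ultimately have "continuous_on {0..} (\<lambda>s. \<sigma> (fst (s, t)) (snd (s, t)) +
      \<phi> (fst (s, t)) * \<sigma> C (max 0 (snd (s, t) - T (fst (s, t)))))"
      by (rule continuous_on_compose2[OF cont'])
    then show "continuous_on {0..} (\<lambda>s. \<sigma> s t + \<phi> s * \<sigma> C (max 0 (t - T s)))" by simp
    have "\<sigma> 0 t = 0" using class_KL_class_K[OF \<sigma> that] by (simp add: class_K_def)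
    then show "\<sigma> 0 t + \<phi> 0 * \<sigma> C (max 0 (t - T 0)) = 0" using \<phi>(3) by simp
    fix s s' :: real assume s: "0 \<le> s" "s < s'"
    have "\<sigma> s t < \<sigma> s' t" using class_K_strict_mono[OF class_KL_class_K[OF \<sigma> that] s] .
    moreover have "\<phi> s * \<sigma> C (max 0 (t - T s)) \<le> \<phi> s' * \<sigma> C (max 0 (t - T s'))"
    proof (rule mult_mono)
      show "\<phi> s \<le> \<phi> s'" using mono_onD[OF \<phi>(2)] s by simp
      have "T s \<le> T s'" using mono_onD[OF T(2)] s by simp
      then show "\<sigma> C (max 0 (t - T s)) \<le> \<sigma> C (max 0 (t - T s'))"
        using \<open>0 \<le> C\<close> by (intro class_KL_antimono[OF \<sigma>]) auto
    qed (use s \<phi>_nonneg \<sigma>_nonneg in auto)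
    ultimately show "\<sigma> s t + \<phi> s * \<sigma> C (max 0 (t - T s)) < \<sigma> s' t + \<phi> s' * \<sigma> C (max 0 (t - T s'))"
      by simp
  qed
  moreover have "antimono_on {0..} (\<lambda>t. \<sigma> s t + \<phi> s * \<sigma> C (max 0 (t - T s)))" if "0 \<le> s" for s
    using that \<open>0 \<le> C\<close>
    by (auto intro!: monotone_onI add_mono mult_left_mono class_KL_antimono[OF \<sigma>] \<phi>_nonneg)
  moreover have "((\<lambda>t. \<sigma> s t + \<phi> s * \<sigma> C (max 0 (t - T s))) \<longlongrightarrow> 0) at_top" if "0 \<le> s" for s
  proof -
    have "filterlim (\<lambda>t. t - T s) at_top at_top"
      using filterlim_tendsto_add_at_top[OF tendsto_const filterlim_ident, of "- T s"] by simp
    then have max: "filterlim (\<lambda>t. max 0 (t - T s)) at_top at_top"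
      by (rule filterlim_at_top_mono) simp
    have lim: "(\<sigma> C \<longlongrightarrow> 0) at_top" "(\<sigma> s \<longlongrightarrow> 0) at_top"
      using \<sigma> \<open>0 \<le> C\<close> that by (simp_all add: class_KL_def)
    from tendsto_add[OF lim(2) tendsto_mult_left[OF filterlim_compose[OF lim(1) max], of "\<phi> s"]] show ?thesis by simp
  qed
  ultimately show ?thesis
    using cont' unfolding class_KL_def by (simp add: case_prod_unfold)
qed

lemma class_K_infinity_add:
  assumes \<gamma>: "class_K_infinity \<gamma>"
    and \<phi>: "continuous_on {0..} \<phi>" "mono_on {0..} \<phi>" "\<phi> 0 = 0"
  shows "class_K_infinity (\<lambda>s. \<gamma> s + \<phi> s)"
proof -
  have K: "class_K \<gamma>" and ub: "\<not> bounded (\<gamma> ` {0..})" using \<gamma> by (auto simp: class_K_infinity_def)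
  have "class_K (\<lambda>s. \<gamma> s + \<phi> s)"
  proof (rule class_KI)
    show "continuous_on {0..} (\<lambda>s. \<gamma> s + \<phi> s)"
      using K \<phi>(1) by (intro continuous_intros) (auto simp: class_K_def)
    show "\<gamma> 0 + \<phi> 0 = 0" using K \<phi>(3) by (simp add: class_K_def)
    show "\<gamma> s + \<phi> s < \<gamma> t + \<phi> t" if "0 \<le> s" "s < t" for s t
      using class_K_strict_mono[OF K that] mono_onD[OF \<phi>(2), of s t] that by simp
  qed
  moreover have "\<not> bounded ((\<lambda>s. \<gamma> s + \<phi> s) ` {0..})"
  proof
    assume "bounded ((\<lambda>s. \<gamma> s + \<phi> s) ` {0..})"
    then obtain M where M: "\<And>s. 0 \<le> s \<Longrightarrow> \<bar>\<gamma> s + \<phi> s\<bar> \<le> M" by (auto simp: bounded_iff)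
    have "\<bar>\<gamma> s\<bar> \<le> M" if "0 \<le> s" for s
      using M[OF that] class_K_nonneg[OF K that] mono_onD[OF \<phi>(2), of 0 s] \<phi>(3) that by simp
    then show False using ub by (auto simp: bounded_iff)
  qed
  ultimately show ?thesis by (simp add: class_K_infinity_def)
qed

section \<open>The patched feedback\<close>

text \<open>A feedback enters through its values at sampled states only, and by invariance these all
  lie in \<Theta>, where \<open>k\<close> and \<open>k1\<close> agree.\<close>

lemma sampled_data_solution_switch_feedback:
  assumes "h > 0" "h1 > 0"
    and y: "sampled_data_solution f k1 h1 d (\<lambda>t. e t + ln (h1 / h)) x0 y"
    and inv: "\<And>t. 0 \<le> t \<Longrightarrow> y t \<in> \<Theta>" and eq: "\<And>x. x \<in> \<Theta> \<Longrightarrow> k x = k1 x"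
  shows "sampled_data_solution f k h d e x0 y"
proof -
  have "k1 (y (sampling_time h e i)) = k (y (sampling_time h e i))" for i
    using inv[OF sampling_time_nonneg[OF \<open>h > 0\<close>]] eq by simp
  then show ?thesis
    using y unfolding sampled_data_solution_def sampling_time_rescale[OF assms(1,2)] by simp
qed

text \<open>Solutions with the constant control \<open>v\<close> are followed up to the first sampling instant at
  which they lie in \<open>A\<close>. Since consecutive sampling instants are at most \<open>r\<close> apart, one of them
  falls into \<open>{T<..T + r}\<close>.\<close>

lemma reachable_sampling_phase:
  assumes "0 < h" "h \<le> r" "0 \<le> T" and e: "e \<in> sampling_perturbations"
    and y: "solves_ode_ae (\<lambda>t z. f (d t) z v) {0..T + r} y"
    and A: "\<And>t. t \<in> {T..T + r} \<Longrightarrow> y t \<in> A" and W: "\<And>t. t \<in> {0..T} \<Longrightarrow> y t \<in> W"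
    and k: "\<And>x. x \<in> W - A \<Longrightarrow> k x = v"
  obtains m where "sampling_time h e m \<le> T + r" "y (sampling_time h e m) \<in> A"
    "\<And>i. i < m \<Longrightarrow> solves_ode_ae (\<lambda>t z. f (d t) z (k (y (sampling_time h e i))))
        {sampling_time h e i..<sampling_time h e (Suc i)} y"
    "\<And>i. i < m \<Longrightarrow> (y \<longlongrightarrow> y (sampling_time h e (Suc i))) (at_left (sampling_time h e (Suc i)))"
proof -
  let ?\<tau> = "sampling_time h e"
  obtain n where n: "?\<tau> n \<le> T" "T < ?\<tau> (Suc n)"
    using sampling_time_interval[OF \<open>0 < h\<close> e \<open>0 \<le> T\<close>] .
  have "0 \<le> e (?\<tau> n)"
    using e sampling_time_nonneg[OF \<open>0 < h\<close>, of e n] by (auto simp: sampling_perturbations_def)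
  then have "h * exp (- e (?\<tau> n)) \<le> r" using assms(1,2) by (smt (verit) exp_le_one_iff mult_left_le)
  then have "?\<tau> (Suc n) \<le> T + r" using n by simp
  then have Suc_n: "?\<tau> (Suc n) \<le> T + r" "y (?\<tau> (Suc n)) \<in> A" using n(2) by (auto intro: A)
  define m where "m = (LEAST m. y (?\<tau> m) \<in> A)"
  have mA: "y (?\<tau> m) \<in> A" unfolding m_def by (rule LeastI) (rule Suc_n(2))
  have "m \<le> Suc n" unfolding m_def by (rule Least_le) (rule Suc_n(2))
  then have le: "?\<tau> i \<le> T + r" if "i \<le> m" for i
    using sampling_time_mono[OF \<open>0 < h\<close>, of i "Suc n" e] that Suc_n(1) by linarith
  have cont: "continuous_on {0..T + r} y"
    using y by (auto simp: solves_ode_ae_def intro: abs_continuous_on_imp_continuous_on)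
  show thesis
  proof (rule that[of m])
    fix i assume "i < m"
    then have nA: "y (?\<tau> i) \<notin> A" using not_less_Least unfolding m_def by blast
    have nn: "0 \<le> ?\<tau> i" by (rule sampling_time_nonneg[OF \<open>0 < h\<close>])
    have lt: "?\<tau> i < ?\<tau> (Suc i)" by (rule sampling_time_less_Suc[OF \<open>0 < h\<close>])
    have Sle: "?\<tau> (Suc i) \<le> T + r" using \<open>i < m\<close> by (intro le) simp
    \<comment> \<open>From \<open>T\<close> to \<open>T + r\<close> every state is in
      \<open>A\<close>, so a sampled state outside \<open>A\<close> occurs before \<open>T\<close>,
      hence lies in \<open>W\<close>, where the feedback is the constant \<open>v\<close>.\<close>
    have "?\<tau> i \<le> T" using nA A[of "?\<tau> i"] le[of i] \<open>i < m\<close> by (cases "?\<tau> i \<le> T") auto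
    then have kv: "k (y (?\<tau> i)) = v" using nA nn W by (intro k) auto
    show "solves_ode_ae (\<lambda>t z. f (d t) z (k (y (?\<tau> i)))) {?\<tau> i..<?\<tau> (Suc i)} y"
      unfolding kv by (rule solves_ode_ae_subset[OF y]) (use nn Sle in auto)
    have "continuous_on {?\<tau> i..?\<tau> (Suc i)} y"
      by (rule continuous_on_subset[OF cont]) (use nn Sle in auto)
    then show "(y \<longlongrightarrow> y (?\<tau> (Suc i))) (at_left (?\<tau> (Suc i)))"
      using continuous_on_Icc_at_leftD[OF _ lt] by blast
  qed (use mA le in auto)
qed

text \<open>Only one good solution is asserted, which is what concatenation can produce; uniqueness
  extends the estimates to all solutions at the very end. The decay profile \<open>\<rho>\<close>
  stays the same throughout the induction, while \<open>B\<close> and \<open>T\<close> may change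
  with the index and the radius.\<close>

definition uniformly_captured ::
    "('d::euclidean_space \<Rightarrow> 'a::real_normed_vector \<Rightarrow> 'u \<Rightarrow> 'a) \<Rightarrow> 'd set \<Rightarrow> ('a \<Rightarrow> 'u) \<Rightarrow> real \<Rightarrow>
      (real \<Rightarrow> real) \<Rightarrow> 'a set \<Rightarrow> real \<Rightarrow> real \<Rightarrow> real \<Rightarrow> bool" where
  "uniformly_captured f D k h \<rho> X R B T \<longleftrightarrow>
     (\<forall>x0\<in>X. norm x0 \<le> R \<longrightarrow> (\<forall>d\<in>L_infinity_loc D. \<forall>e\<in>sampling_perturbations.
        \<exists>y. sampled_data_solution f k h d e x0 y \<and> (\<forall>t\<ge>0. norm (y t) \<le> B) \<and>
            (\<forall>t\<ge>T. norm (y t) \<le> \<rho> (t - T))))"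

text \<open>Reachability with the control \<open>v\<close> exposed, so that one control per index
  can be chosen and built into the feedback.\<close>

definition reachable_by_constant ::
    "('d::euclidean_space \<Rightarrow> 'a::real_normed_vector \<Rightarrow> 'u \<Rightarrow> 'a) \<Rightarrow> 'd set \<Rightarrow> real \<Rightarrow>
      'a set \<Rightarrow> 'a set \<Rightarrow> 'u \<Rightarrow> bool" where
  "reachable_by_constant f D r A W v \<longleftrightarrow>
     (\<exists>c\<ge>0. \<exists>a b. class_N a \<and> class_N b \<and>
        (\<forall>x0\<in>W. \<forall>d\<in>L_infinity_loc D. \<exists>T\<in>{0..c + b (norm x0)}.
           solution_exists_and_satisfies
             (\<lambda>x. x 0 = x0 \<and> solves_ode_ae (\<lambda>t z. f (d t) z v) {0..T + r} x)
             (\<lambda>x. (\<forall>t\<in>{0..T + r}. norm (x t) \<le> a (norm x0)) \<and>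
                  (\<forall>t\<in>{T..T + r}. x t \<in> A) \<and> (\<forall>t\<in>{0..T}. x t \<in> W))))"

lemma robustly_reachable_iff:
  "robustly_reachable f D U r A W \<longleftrightarrow> (\<exists>v\<in>U. reachable_by_constant f D r A W v)"
  unfolding robustly_reachable_def reachable_by_constant_def ..

text \<open>From \<open>W - A\<close> the control \<open>v\<close> leads into \<open>A\<close> at a
  sampling instant not later than \<open>c + b R' + r\<close>, at a state of norm at most
  \<open>a R'\<close>, and the induction hypothesis takes over. Since \<open>a R'\<close> may exceed
  \<open>R\<close>, that hypothesis must hold for all radii.\<close>

lemma uniformly_captured_reachable_step:
  fixes f :: "'d::euclidean_space \<Rightarrow> 'a::real_normed_vector \<Rightarrow> 'u \<Rightarrow> 'a"
  assumes "0 < h" "h \<le> r"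
    and \<rho>: "\<And>s t. 0 \<le> s \<Longrightarrow> s \<le> t \<Longrightarrow> \<rho> t \<le> \<rho> s"
    and k: "\<And>x. x \<in> W - A \<Longrightarrow> k x = v"
    and reachable: "reachable_by_constant f D r A W v"
    and IH: "\<And>R. \<exists>B T. 0 \<le> T \<and> uniformly_captured f D k h \<rho> A R B T"
  shows "\<exists>B T. 0 \<le> T \<and> uniformly_captured f D k h \<rho> (A \<union> W) R B T"
proof -
  from reachable obtain c a b where "0 \<le> c" and a: "class_N a" and b: "class_N b" and
    reach: "\<forall>x0\<in>W. \<forall>d\<in>L_infinity_loc D. \<exists>T\<in>{0..c + b (norm x0)}.
           solution_exists_and_satisfies
             (\<lambda>x. x 0 = x0 \<and> solves_ode_ae (\<lambda>t z. f (d t) z v) {0..T + r} x)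
             (\<lambda>x. (\<forall>t\<in>{0..T + r}. norm (x t) \<le> a (norm x0)) \<and>
                  (\<forall>t\<in>{T..T + r}. x t \<in> A) \<and> (\<forall>t\<in>{0..T}. x t \<in> W))"
    unfolding reachable_by_constant_def by blast
  \<comment> \<open>This keeps the radius in \<open>{0..}\<close>, the domain on which
    \<open>a\<close> and \<open>b\<close> are monotone.\<close>
  define R' where "R' = max R 0"
  obtain B1 T1 where "0 \<le> T1" and 1: "uniformly_captured f D k h \<rho> A R B1 T1" using IH by blast
  obtain B2 T2 where "0 \<le> T2" and 2: "uniformly_captured f D k h \<rho> A (a R') B2 T2" using IH by blast
  define B where "B = max (max B1 B2) (a R')"
  \<comment> \<open>Longest waiting time, length of the window, and capture time from radius
    \<open>a R'\<close>. Enlarging a capture time is harmless because \<open>\<rho>\<close> is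
    nonincreasing.\<close>
  define T where "T = max T1 (c + b R' + r + T2)"
  have "\<exists>y. sampled_data_solution f k h d e x0 y \<and> (\<forall>t\<ge>0. norm (y t) \<le> B) \<and>
      (\<forall>t\<ge>T. norm (y t) \<le> \<rho> (t - T))"
    if x0: "x0 \<in> A \<union> W" "norm x0 \<le> R" and d: "d \<in> L_infinity_loc D" and e: "e \<in> sampling_perturbations"
    for x0 d e
  \<comment> \<open>A start in \<open>A\<close> is treated separately, because there the feedback
    may differ from \<open>v\<close>.\<close>
  proof (cases "x0 \<in> A")
    case True
    then obtain y where y: "sampled_data_solution f k h d e x0 y" "\<And>t. t \<ge> 0 \<Longrightarrow> norm (y t) \<le> B1"
      "\<And>t. t \<ge> T1 \<Longrightarrow> norm (y t) \<le> \<rho> (t - T1)"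
      using 1 x0(2) d e unfolding uniformly_captured_def by blast
    have "norm (y t) \<le> \<rho> (t - T)" if "t \<ge> T" for t
      using y(3)[of t] \<rho>[of "t - T" "t - T1"] that by (simp add: T_def)
    moreover have "norm (y t) \<le> B" if "t \<ge> 0" for t using y(2)[OF that] by (simp add: B_def)
    ultimately show ?thesis using y(1) by blast
  next
    case False
    then have "x0 \<in> W" using x0 by simp
    have mono: "a (norm x0) \<le> a R'" "b (norm x0) \<le> b R'"
      using mono_onD[of "{0..}" a "norm x0" R'] mono_onD[of "{0..}" b "norm x0" R'] a b x0(2)
      by (simp_all add: class_N_def R'_def)
    from reach \<open>x0 \<in> W\<close> d obtain T0 where "T0 \<in> {0..c + b (norm x0)}" and
      "solution_exists_and_satisfies
             (\<lambda>x. x 0 = x0 \<and> solves_ode_ae (\<lambda>t z. f (d t) z v) {0..T0 + r} x)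
             (\<lambda>x. (\<forall>t\<in>{0..T0 + r}. norm (x t) \<le> a (norm x0)) \<and>
                  (\<forall>t\<in>{T0..T0 + r}. x t \<in> A) \<and> (\<forall>t\<in>{0..T0}. x t \<in> W))" by blast
    then obtain y where T0: "0 \<le> T0" "T0 \<le> c + b (norm x0)" and y0: "y 0 = x0"
      and y: "solves_ode_ae (\<lambda>t z. f (d t) z v) {0..T0 + r} y"
      and bd: "\<And>t. t \<in> {0..T0 + r} \<Longrightarrow> norm (y t) \<le> a (norm x0)"
      and yA: "\<And>t. t \<in> {T0..T0 + r} \<Longrightarrow> y t \<in> A" and yW: "\<And>t. t \<in> {0..T0} \<Longrightarrow> y t \<in> W"
      unfolding solution_exists_and_satisfies_def by auto
    obtain m where m: "sampling_time h e m \<le> T0 + r" "y (sampling_time h e m) \<in> A"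
      "\<And>i. i < m \<Longrightarrow> solves_ode_ae (\<lambda>t z. f (d t) z (k (y (sampling_time h e i))))
        {sampling_time h e i..<sampling_time h e (Suc i)} y"
      "\<And>i. i < m \<Longrightarrow> (y \<longlongrightarrow> y (sampling_time h e (Suc i))) (at_left (sampling_time h e (Suc i)))"
      using reachable_sampling_phase[where f = f and d = d and v = v and y = y and A = A and W = W and k = k,
          OF assms(1,2) T0(1) e y yA yW k] by blast
    define s where "s = sampling_time h e m"
    have "0 \<le> s" unfolding s_def by (rule sampling_time_nonneg[OF \<open>0 < h\<close>])
    have bd': "norm (y t) \<le> a R'" if "0 \<le> t" "t \<le> s" for t
      using bd[of t] that m(1) mono(1) by (simp add: s_def)
    from m(2) have "y s \<in> A" by (simp add: s_def)
    with 2 bd'[OF \<open>0 \<le> s\<close> order_refl] L_infinity_loc_shift[OF d \<open>0 \<le> s\<close>]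
      sampling_perturbations_shift[OF e \<open>0 \<le> s\<close>]
    obtain z where z: "sampled_data_solution f k h (\<lambda>t. d (t + s)) (\<lambda>t. e (t + s)) (y s) z"
      "\<And>t. t \<ge> 0 \<Longrightarrow> norm (z t) \<le> B2" "\<And>t. t \<ge> T2 \<Longrightarrow> norm (z t) \<le> \<rho> (t - T2)"
      unfolding uniformly_captured_def by blast
    define x where "x t = (if t < s then y t else z (t - s))" for t
    have "sampled_data_solution f k h d e (y 0) x"
      unfolding x_def[abs_def] s_def
      by (rule sampled_data_solution_concat[where f = f and d = d and k = k and y = y, OF \<open>0 < h\<close> m(3,4)]) (use z(1) s_def in auto)
    moreover have "norm (x t) \<le> B" if "0 \<le> t" for t
      using bd'[of t] z(2)[of "t - s"] that by (auto simp: x_def B_def)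
    moreover have "norm (x t) \<le> \<rho> (t - T)" if "T \<le> t" for t
    proof -
      have "s + T2 \<le> T" using m(1) T0(2) mono(2) by (simp add: s_def T_def)
      then have "norm (z (t - s)) \<le> \<rho> (t - s - T2)" "\<rho> (t - s - T2) \<le> \<rho> (t - T)"
        using that by (auto intro!: z(3) \<rho>)
      moreover have "\<not> t < s" using \<open>s + T2 \<le> T\<close> \<open>0 \<le> T2\<close> that by simp
      ultimately show ?thesis by (simp add: x_def)
    qed
    ultimately show ?thesis unfolding y0 by blast
  qed
  then have "uniformly_captured f D k h \<rho> (A \<union> W) R B T" unfolding uniformly_captured_def by blast
  moreover have "0 \<le> T" using \<open>0 \<le> T1\<close> by (simp add: T_def)
  ultimately show ?thesis by blast
qed

theorem theorem3p2:
  fixes f :: "real^'l \<Rightarrow> real^'n \<Rightarrow> real^'m \<Rightarrow> real^'n"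
    and D :: "(real^'l) set" and U :: "(real^'m) set"
    and k1 :: "real^'n \<Rightarrow> real^'m" and \<Theta> :: "(real^'n) set"
    and \<gamma> :: "real \<Rightarrow> real" and h1 :: real and \<sigma> :: "real \<Rightarrow> real \<Rightarrow> real"
    and r :: real and \<Omega> :: "nat \<Rightarrow> (real^'n) set"
  assumes "D \<noteq> {}" and "H1 f D U" and "H2 f D U"
    and P1_feedback: "range k1 \<subseteq> U" "locally_bounded_on UNIV k1" "k1 0 = 0"
    and P1_set: "bounded \<Theta>" "open \<Theta>" "\<exists>\<epsilon>>0. ball 0 \<epsilon> \<subseteq> \<Theta>"
    and P1_gain: "class_K_infinity \<gamma>"
      "\<forall>d\<in>D. \<forall>z x. norm (f d z (k1 x)) \<le> \<gamma> (norm z + norm x)"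
    and P1_stability: "h1 > 0" "class_KL \<sigma>"
      "\<forall>x0\<in>\<Theta>. \<forall>d\<in>L_infinity_loc D. \<forall>e\<in>sampling_perturbations.
         solution_exists_and_satisfies
           (sampled_data_solution f k1 h1 d e x0)
           (\<lambda>x. \<forall>t\<ge>0. norm (x t) \<le> \<sigma> (norm x0) t \<and> x t \<in> \<Theta>)"
    and P3_cover: "r > 0" "\<Omega> 1 = \<Theta>" "(\<Union>j\<in>{1..}. \<Omega> j) = UNIV"
    and P3_reach: "\<forall>j\<ge>2. robustly_reachable f D U r (\<Union>i\<in>{1..j - 1}. \<Omega> i) (\<Omega> j)"
    and P3_compact: "\<forall>K. compact K \<longrightarrow> (\<exists>N\<ge>2. K \<subseteq> (\<Union>j\<in>{1..N}. \<Omega> j))"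
  shows "robustly_globally_stabilizable f D U"
proof -

  \<comment> \<open>Construction of the feedback\<close>
  have \<Omega>1: "\<Omega> 1 = \<Theta>" and \<Omega>_UN: "(\<Union>j\<in>{1..}. \<Omega> j) = UNIV" using P3_cover by auto
  obtain \<epsilon> where "\<epsilon> > 0" "ball 0 \<epsilon> \<subseteq> \<Theta>" using P1_set(3) by blast
  then have out: "\<epsilon> \<le> norm x" if "x \<notin> \<Theta>" for x using that by (force simp: not_less[symmetric])
  have "0 \<in> \<Theta>" using \<open>\<epsilon> > 0\<close> \<open>ball 0 \<epsilon> \<subseteq> \<Theta>\<close> by auto
  obtain C where "C > 0" and C: "\<And>x. x \<in> \<Theta> \<Longrightarrow> norm x \<le> C" using P1_set(1) by (auto simp: bounded_pos)
  define A where "A j = (\<Union>i\<in>{1..j}. \<Omega> i)" for j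
  have A_Suc: "A (Suc j) = A j \<union> \<Omega> (Suc j)" for j
    unfolding A_def by (simp add: atLeastAtMostSuc_conv Un_commute)
  have "\<exists>v\<in>U. reachable_by_constant f D r (A (j - 1)) (\<Omega> j) v" if "2 \<le> j" for j
    using P3_reach that by (simp add: robustly_reachable_iff A_def)
  then obtain V where V: "\<And>j. 2 \<le> j \<Longrightarrow> V j \<in> U"
    "\<And>j. 2 \<le> j \<Longrightarrow> reachable_by_constant f D r (A (j - 1)) (\<Omega> j) (V j)" by metis
  \<comment> \<open>Choosing the least index makes the index strictly decrease as soon as a sampling instant
    finds the state in an earlier set.\<close>
  define J where "J x = (LEAST j. 1 \<le> j \<and> x \<in> \<Omega> j)" for x
  have J: "1 \<le> J x \<and> x \<in> \<Omega> (J x)" for x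
    unfolding J_def by (rule LeastI_ex) (use \<Omega>_UN in blast)
  have J_le: "J x \<le> j" if "1 \<le> j" "x \<in> \<Omega> j" for x j
    unfolding J_def using that by (intro Least_le) auto
  define k where "k x = (if x \<in> \<Theta> then k1 x else V (J x))" for x
  have k_in: "k x = k1 x" if "x \<in> \<Theta>" for x using that by (simp add: k_def)
  have J2: "2 \<le> J x" if "x \<notin> \<Theta>" for x
    using J[of x] that \<Omega>1 by (cases "J x = 1") auto
  \<comment> \<open>The points of \<open>\<Omega> (Suc j) - A j\<close> are exactly those of least
    index \<open>Suc j\<close>, and \<open>1 \<le> j\<close> keeps them off \<Theta>.\<close>
  have k_out: "k x = V (Suc j)" if "x \<in> \<Omega> (Suc j) - A j" "1 \<le> j" for x j
  proof -
    have "J x \<le> Suc j" using J_le[of "Suc j" x] that by auto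
    moreover have "\<not> J x \<le> j" using J[of x] that unfolding A_def by auto
    moreover have "x \<notin> \<Theta>" using that unfolding A_def by (auto simp flip: \<Omega>1)
    ultimately show ?thesis by (simp add: k_def le_Suc_eq)
  qed
  have k_U: "range k \<subseteq> U" using P1_feedback(1) V(1) J2 by (auto simp: k_def)
  \<comment> \<open>Finitely many of the sets cover \<open>K\<close>, which bounds the least index
    there; off \<Theta> the feedback then takes only finitely many values on
    \<open>K\<close>.\<close>
  have k_bdd: "bounded (k ` K)" if K: "compact K" for K
  proof -
    obtain N where N: "K \<subseteq> (\<Union>j\<in>{1..N}. \<Omega> j)" using P3_compact K by blast
    have "k ` K \<subseteq> k1 ` K \<union> V ` {1..N}"
    proof (rule image_subsetI)
      fix x assume "x \<in> K"
      then obtain j where "j \<in> {1..N}" "x \<in> \<Omega> j" using N by blast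
      then have "J x \<in> {1..N}" using J_le[of j x] J[of x] by simp
      then show "k x \<in> k1 ` K \<union> V ` {1..N}" using \<open>x \<in> K\<close> by (auto simp: k_def)
    qed
    moreover have "bounded (k1 ` K \<union> V ` {1..N})"
      using P1_feedback(2) K by (auto simp: locally_bounded_on_def finite_imp_bounded)
    ultimately show ?thesis by (rule bounded_subset[rotated])
  qed
  define h where "h = min h1 r"
  have h: "h > 0" "h \<le> h1" "h \<le> r" using P1_stability(1) P3_cover(1) by (auto simp: h_def)

  \<comment> \<open>Uniform capture by \<Theta>\<close>
  have inner: "\<exists>y. sampled_data_solution f k h d e x0 y \<and> (\<forall>t\<ge>0. norm (y t) \<le> \<sigma> (norm x0) t)"
    if x0: "x0 \<in> \<Theta>" and de: "d \<in> L_infinity_loc D" "e \<in> sampling_perturbations" for x0 d e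
  proof -
    \<comment> \<open>Perturbations are nonnegative, and so is the added constant because
      \<open>h \<le> h1\<close>.\<close>
    have "(\<lambda>t. e t + ln (h1 / h)) \<in> sampling_perturbations"
      using de(2) h by (intro sampling_perturbations_add_const) auto
    then obtain y where y: "sampled_data_solution f k1 h1 d (\<lambda>t. e t + ln (h1 / h)) x0 y"
      "\<And>t. 0 \<le> t \<Longrightarrow> norm (y t) \<le> \<sigma> (norm x0) t \<and> y t \<in> \<Theta>"
      using P1_stability(3) x0 de(1) unfolding solution_exists_and_satisfies_def by blast
    then have "sampled_data_solution f k h d e x0 y"
      using sampled_data_solution_switch_feedback[OF h(1) P1_stability(1) y(1)] k_in by blast
    then show ?thesis using y(2) by blast
  qed

  have \<sigma>C_mono: "\<sigma> C t \<le> \<sigma> C s" if "0 \<le> s" "s \<le> t" for s t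
    using class_KL_antimono[OF P1_stability(2)] \<open>C > 0\<close> that by simp
  have captured: "\<exists>B T. 0 \<le> T \<and> uniformly_captured f D k h (\<sigma> C) (A j) R B T" if "1 \<le> j" for j R
    using that
  proof (induction j arbitrary: R rule: dec_induct)
    case base
    \<comment> \<open>A start in \<Theta> is captured at time 0, and replacing
      \<open>norm x0\<close> by \<open>C\<close> gives the common decay profile.\<close>
    have "uniformly_captured f D k h (\<sigma> C) (A 1) R (\<sigma> C 0) 0"
      unfolding uniformly_captured_def
    proof (intro ballI impI)
      fix x0 d e assume "x0 \<in> A 1" and de: "d \<in> L_infinity_loc D" "e \<in> sampling_perturbations"
      then have "x0 \<in> \<Theta>" by (simp add: A_def flip: \<Omega>1)
      obtain y where y: "sampled_data_solution f k h d e x0 y"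
        "\<And>t. t \<ge> 0 \<Longrightarrow> norm (y t) \<le> \<sigma> (norm x0) t" using inner[OF \<open>x0 \<in> \<Theta>\<close> de] by blast
      have "norm (y t) \<le> \<sigma> C t" if "0 \<le> t" for t
        using y(2)[OF that] class_K_mono[OF class_KL_class_K[OF P1_stability(2) that] norm_ge_zero C[OF \<open>x0 \<in> \<Theta>\<close>]]
        by linarith
      moreover from this \<sigma>C_mono have "norm (y t) \<le> \<sigma> C 0" if "0 \<le> t" for t
        using that by (meson order_refl order_trans)
      ultimately show "\<exists>y. sampled_data_solution f k h d e x0 y \<and> (\<forall>t\<ge>0. norm (y t) \<le> \<sigma> C 0) \<and>
          (\<forall>t\<ge>0. norm (y t) \<le> \<sigma> C (t - 0))" using y(1) by auto
    qed
    then show ?case by blast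
  next
    case (step j)
    have "reachable_by_constant f D r (A j) (\<Omega> (Suc j)) (V (Suc j))"
      using V(2)[of "Suc j"] step.hyps by simp
    from uniformly_captured_reachable_step[OF h(1,3) \<sigma>C_mono k_out[OF _ step.hyps(1)] this step.IH]
    show ?case unfolding A_Suc by blast
  qed
  \<comment> \<open>Each closed ball lies in some \<open>A N\<close>. Nothing is known about how the
    resulting bounds vary with \<open>n\<close>, hence the majorants below.\<close>
  have "\<exists>B T. uniformly_captured f D k h (\<sigma> C) (cball 0 (real n)) (real n) B T" for n
  proof -
    obtain N where "2 \<le> N" "cball 0 (real n) \<subseteq> A N"
      using P3_compact compact_cball unfolding A_def by blast
    moreover have "1 \<le> N" using \<open>2 \<le> N\<close> by simp
    then obtain B T where "uniformly_captured f D k h (\<sigma> C) (A N) (real n) B T"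
      using captured by blast
    ultimately show ?thesis unfolding uniformly_captured_def by blast
  qed
  then obtain B T where BT: "\<And>n. uniformly_captured f D k h (\<sigma> C) (cball 0 (real n)) (real n) (B n) (T n)"
    by metis

  \<comment> \<open>Construction of the KL function\<close>
  obtain Bm :: "real \<Rightarrow> real" where Bm: "continuous_on {0..} Bm" "mono_on {0..} Bm" "\<And>s. 0 \<le> s \<Longrightarrow> 0 \<le> Bm s"
    "\<And>s. 0 \<le> s \<Longrightarrow> B (nat \<lceil>s\<rceil>) \<le> Bm s" using continuous_mono_majorant[of B] by auto
  obtain Tm :: "real \<Rightarrow> real" where Tm: "continuous_on {0..} Tm" "mono_on {0..} Tm" "\<And>s. 0 \<le> s \<Longrightarrow> 0 \<le> Tm s"
    "\<And>s. 0 \<le> s \<Longrightarrow> T (nat \<lceil>s\<rceil>) \<le> Tm s" using continuous_mono_majorant[of T] by auto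
  have \<sigma>C0: "\<sigma> C 0 > 0"
    using class_K_strict_mono[OF class_KL_class_K[OF P1_stability(2)], of 0 0 C] \<open>C > 0\<close>
      class_K_nonneg[OF class_KL_class_K[OF P1_stability(2)], of 0 0] by simp
  \<comment> \<open>\<open>\<sigma>' s\<close> dominates the transient bound \<open>Bm s\<close> before time \<open>Tm s\<close> and \<open>\<sigma> C\<close> delayed by \<open>Tm s\<close> afterwards.\<close>
  define \<phi> :: "real \<Rightarrow> real" where "\<phi> s = s / \<epsilon> * (1 + Bm s / \<sigma> C 0)" for s
  have \<phi>: "continuous_on {0..} \<phi>" "mono_on {0..} \<phi>" "\<phi> 0 = 0"
  proof -
    show "continuous_on {0..} \<phi>"
      unfolding \<phi>_def using \<open>\<epsilon> > 0\<close> \<sigma>C0 by (intro continuous_intros Bm(1)) auto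
    show "mono_on {0..} \<phi>"
    proof (rule mono_onI)
      fix s t :: real assume st: "s \<in> {0..}" "t \<in> {0..}" "s \<le> t"
      then have "Bm s \<le> Bm t" using mono_onD[OF Bm(2)] by blast
      then show "\<phi> s \<le> \<phi> t"
        unfolding \<phi>_def using st \<open>\<epsilon> > 0\<close> \<sigma>C0 Bm(3)
        by (intro mult_mono add_left_mono divide_right_mono) auto
    qed
    show "\<phi> 0 = 0" by (simp add: \<phi>_def)
  qed
  define \<sigma>' where "\<sigma>' s t = \<sigma> s t + \<phi> s * \<sigma> C (max 0 (t - Tm s))" for s t
  have \<sigma>': "class_KL \<sigma>'"
    unfolding \<sigma>'_def[abs_def]
    by (rule class_KL_add_delayed[OF P1_stability(2) _ \<phi> Tm(1,2)]) (use \<open>C > 0\<close> in simp)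
  have \<sigma>_nonneg: "0 \<le> \<sigma> s t" if "0 \<le> s" "0 \<le> t" for s t
    using class_K_nonneg[OF class_KL_class_K[OF P1_stability(2) that(2)] that(1)] .

  have stable: "\<exists>y. sampled_data_solution f k h d e x0 y \<and> (\<forall>t\<ge>0. norm (y t) \<le> \<sigma>' (norm x0) t)"
    if de: "d \<in> L_infinity_loc D" "e \<in> sampling_perturbations" for x0 d e
  proof (cases "x0 \<in> \<Theta>")
    case True
    have "\<sigma> (norm x0) t \<le> \<sigma>' (norm x0) t" for t
      using mono_onD[OF \<phi>(2), of 0 "norm x0"] \<phi>(3) \<sigma>_nonneg[of C] \<open>C > 0\<close> by (simp add: \<sigma>'_def)
    then show ?thesis using inner[OF True de] by (meson order_trans)
  next
    case False
    define s where "s = norm x0"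
    define n where "n = nat \<lceil>s\<rceil>"
    have s: "0 \<le> s" "\<epsilon> \<le> s" using out[OF False] by (auto simp: s_def)
    have "s \<le> real n" unfolding n_def by (rule real_nat_ceiling_ge)
    then have x0: "x0 \<in> cball 0 (real n)" "norm x0 \<le> real n" by (auto simp: s_def)
    with BT[of n] de obtain y where y: "sampled_data_solution f k h d e x0 y"
      "\<And>t. t \<ge> 0 \<Longrightarrow> norm (y t) \<le> B n" "\<And>t. t \<ge> T n \<Longrightarrow> norm (y t) \<le> \<sigma> C (t - T n)"
      unfolding uniformly_captured_def by blast
    \<comment> \<open>Two estimates in one: \<open>\<phi> s \<ge> 1\<close> preserves the decay
      bound after \<open>Tm s\<close>, and \<open>\<phi> s * \<sigma> C 0 \<ge> Bm s\<close> covers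
      the transient.\<close>
    have "1 + Bm s / \<sigma> C 0 \<le> \<phi> s"
    proof -
      have "1 \<le> s / \<epsilon>" using s \<open>\<epsilon> > 0\<close> by simp
      then have "1 * (1 + Bm s / \<sigma> C 0) \<le> s / \<epsilon> * (1 + Bm s / \<sigma> C 0)"
        using Bm(3)[OF s(1)] \<sigma>C0 by (intro mult_right_mono) auto
      then show ?thesis by (simp add: \<phi>_def)
    qed
    moreover have "0 \<le> Bm s / \<sigma> C 0" using Bm(3)[OF s(1)] \<sigma>C0 by simp
    ultimately have \<phi>s: "1 \<le> \<phi> s" "Bm s / \<sigma> C 0 \<le> \<phi> s" by linarith+
    have "norm (y t) \<le> \<phi> s * \<sigma> C (max 0 (t - Tm s))" if "0 \<le> t" for t
    proof (cases "Tm s \<le> t")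
      case True
      have "T n \<le> Tm s" using Tm(4)[OF s(1)] by (simp add: n_def)
      then have "norm (y t) \<le> \<sigma> C (t - T n)" "\<sigma> C (t - T n) \<le> \<sigma> C (t - Tm s)"
        using True by (auto intro!: y(3) \<sigma>C_mono)
      moreover have "1 * \<sigma> C (t - Tm s) \<le> \<phi> s * \<sigma> C (t - Tm s)"
        using \<phi>s(1) \<sigma>_nonneg[of C "t - Tm s"] \<open>C > 0\<close> True by (intro mult_right_mono) auto
      ultimately show ?thesis using True by simp
    next
      case False
      have "norm (y t) \<le> Bm s" using y(2)[OF that] Bm(4)[OF s(1)] by (simp add: n_def)
      also have "\<dots> \<le> \<phi> s * \<sigma> C 0" using \<phi>s(2) \<sigma>C0 by (simp add: pos_divide_le_eq)
      finally show ?thesis using False by simp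
    qed
    then have "norm (y t) \<le> \<sigma>' s t" if "0 \<le> t" for t
      using \<sigma>_nonneg[OF s(1) that] that by (force simp: \<sigma>'_def)
    then show ?thesis using y(1) by (auto simp: s_def)
  qed

  \<comment> \<open>Gain of the feedback\<close>
  obtain a where a: "class_K_infinity a" "\<And>u d x. u \<in> U \<Longrightarrow> d \<in> D \<Longrightarrow> norm (f d x u) \<le> a (norm x + norm u)"
    using \<open>H2 f D U\<close> unfolding H2_def by blast
  then have "class_K a" by (simp add: class_K_infinity_def)
  have "\<exists>c. \<forall>x\<in>cball 0 (real n). norm (k x) \<le> c" for n
    using k_bdd[OF compact_cball, of 0 "real n"] by (auto simp: bounded_iff)
  then obtain c where c: "\<And>n x. norm x \<le> real n \<Longrightarrow> norm (k x) \<le> c n" by (metis mem_cball_0)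
  obtain P :: "real \<Rightarrow> real" where P: "continuous_on {0..} P" "mono_on {0..} P" "\<And>s. 0 \<le> s \<Longrightarrow> 0 \<le> P s"
    "\<And>s. 0 \<le> s \<Longrightarrow> c (nat \<lceil>s\<rceil>) \<le> P s" using continuous_mono_majorant[of c] by auto
  \<comment> \<open>Off \<open>\<Theta>\<close> one has \<open>s \<ge> \<epsilon>\<close>, so the factor \<open>s / \<epsilon>\<close> is at least 1; it makes the gain vanish at 0.\<close>
  define \<psi> :: "real \<Rightarrow> real" where "\<psi> s = s / \<epsilon> * a (s + P s)" for s
  have \<psi>: "continuous_on {0..} \<psi>" "mono_on {0..} \<psi>" "\<psi> 0 = 0"
  proof -
    have "continuous_on {0..} (\<lambda>s. a (s + P s))"
    proof (rule continuous_on_compose2[where g = a])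
      show "continuous_on {0..} a" using \<open>class_K a\<close> by (simp add: class_K_def)
      show "continuous_on {0..} (\<lambda>s. s + P s)" by (intro continuous_intros P(1))
      show "(\<lambda>s. s + P s) ` {0..} \<subseteq> {0..}" by (simp add: image_subset_iff P(3))
    qed
    then show "continuous_on {0..} \<psi>"
      unfolding \<psi>_def using \<open>\<epsilon> > 0\<close> by (intro continuous_intros) auto
    show "mono_on {0..} \<psi>"
    proof (rule mono_onI)
      fix s t :: real assume st: "s \<in> {0..}" "t \<in> {0..}" "s \<le> t"
      then have "P s \<le> P t" using mono_onD[OF P(2)] by blast
      moreover have "0 \<le> s + P s" using st P(3)[of s] by simp
      ultimately have "a (s + P s) \<le> a (t + P t)" "0 \<le> a (s + P s)"
        using st class_K_mono[OF \<open>class_K a\<close>, of "s + P s" "t + P t"]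
          class_K_nonneg[OF \<open>class_K a\<close>, of "s + P s"] by simp_all
      then show "\<psi> s \<le> \<psi> t"
        unfolding \<psi>_def using st \<open>\<epsilon> > 0\<close> by (intro mult_mono divide_right_mono) auto
    qed
    show "\<psi> 0 = 0" by (simp add: \<psi>_def)
  qed
  \<comment> \<open>On \<Theta> the gain of (P1) applies; off \<Theta>, (H2) is combined with
    \<open>norm (k x) \<le> P s\<close>. The sum of the two bounds dominates either case.\<close>
  have gain: "norm (f d z (k x)) \<le> \<gamma> (norm z + norm x) + \<psi> (norm z + norm x)" if "d \<in> D" for d z x
  proof -
    define s where "s = norm z + norm x"
    have s: "0 \<le> s" "norm x \<le> s" by (auto simp: s_def)
    have \<gamma>_nonneg: "0 \<le> \<gamma> s" using P1_gain(1) s(1) class_K_nonneg by (auto simp: class_K_infinity_def)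
    show ?thesis
    proof (cases "x \<in> \<Theta>")
      case True
      then have "norm (f d z (k x)) \<le> \<gamma> s" using P1_gain(2) that by (simp add: k_in s_def)
      moreover have "0 \<le> \<psi> s" using mono_onD[OF \<psi>(2), of 0 s] \<psi>(3) s(1) by simp
      ultimately show ?thesis by (simp add: s_def)
    next
      case False
      have "1 \<le> s / \<epsilon>" using out[OF False] s \<open>\<epsilon> > 0\<close> by simp
      have "norm x \<le> real (nat \<lceil>s\<rceil>)" using s(2) real_nat_ceiling_ge order_trans by blast
      then have "norm (k x) \<le> P s" using c P(4)[OF s(1)] order_trans by blast
      moreover have "norm z \<le> s" by (simp add: s_def)
      ultimately have "norm z + norm (k x) \<le> s + P s" by simp
      then have "a (norm z + norm (k x)) \<le> a (s + P s)" by (intro class_K_mono[OF \<open>class_K a\<close>]) auto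
      moreover have "norm (f d z (k x)) \<le> a (norm z + norm (k x))" using k_U that by (intro a(2)) auto
      moreover have "1 * a (s + P s) \<le> \<psi> s"
        unfolding \<psi>_def using \<open>1 \<le> s / \<epsilon>\<close> P(3)[OF s(1)] s(1)
        by (intro mult_right_mono class_K_nonneg[OF \<open>class_K a\<close>]) auto
      ultimately show ?thesis using \<gamma>_nonneg by (simp add: s_def)
    qed
  qed

  \<comment> \<open>From the constructed solution to all solutions\<close>
  show ?thesis
    unfolding robustly_globally_stabilizable_def
  proof (intro exI[of _ k] exI[of _ "\<lambda>s. \<gamma> s + \<psi> s"] exI[of _ h] exI[of _ \<sigma>'] conjI allI ballI)
    show "locally_bounded_on UNIV k" using k_bdd by (simp add: locally_bounded_on_def)
    show "k 0 = 0" using \<open>0 \<in> \<Theta>\<close> P1_feedback(3) by (simp add: k_def)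
    show "class_K_infinity (\<lambda>s. \<gamma> s + \<psi> s)" by (rule class_K_infinity_add[OF P1_gain(1) \<psi>])
    fix x0 d e assume de: "d \<in> L_infinity_loc D" "e \<in> sampling_perturbations"
    obtain y where y: "sampled_data_solution f k h d e x0 y"
      "\<And>t. t \<ge> 0 \<Longrightarrow> norm (y t) \<le> \<sigma>' (norm x0) t" using stable[OF de] by blast
    have "d ` {0..} \<subseteq> D" using de(1) by (simp add: L_infinity_loc_def)
    \<comment> \<open>The estimate is known for the glued solution \<open>y\<close>; uniqueness
      transfers it to an arbitrary solution.\<close>
    then have "x t = y t" if "sampled_data_solution f k h d e x0 x" "0 \<le> t" for x t
      using sampled_data_solution_unique[OF \<open>H1 f D U\<close> k_U h(1) _ de(2) that(1) y(1) that(2)] by blast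
    then have "norm (x t) \<le> \<sigma>' (norm x0) t" if "sampled_data_solution f k h d e x0 x" "0 \<le> t" for x t
      using y(2) that by simp
    then show "solution_exists_and_satisfies (sampled_data_solution f k h d e x0)
        (\<lambda>x. \<forall>t\<ge>0. norm (x t) \<le> \<sigma>' (norm x0) t)"
      unfolding solution_exists_and_satisfies_def using y(1) by blast
  qed (rule k_U h(1) \<sigma>' gain; assumption?)+
qed

end
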